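(* Let $m>0$, let $u=u(q,p,x,y,t)\in\mathrm{Lip}(\mathbb{R}^5,\mathbb{R})$, let $M=\{(q,p,x,y)\in\mathbb{R}^4 : 0<q<\pi\}$, let $t_0\in\mathbb{R}$, and let $\mu\in M$ be an equilibrium of the system $$\dot q=p,\qquad \dot p=\frac{u(q,p,x,y,t)\sin q+p^2\sin q\cos q-(1+m)\cos q}{m+\cos^2q},$$ $$\dot x=y,\qquad \dot y=\frac{u(q,p,x,y,t)+p^2\cos q-\sin q\cos q}{m+\cos^2q}.$$ Suppose there exist a closed subset $U\subset M$ with $\mu\in U\setminus\partial U$ and a $C^1$-function $V\colon U\to\mathbb{R}$ such that (L1) $V(\mu)=0$ and $V>0$ on $U\setminus\{\mu\}$; (L2) the derivative $\dot V$ of $V$ along the system is negative on $U\setminus\{\mu\}$ for all $t$. Then there exist an initial condition $(q_0,p_0,x_0,y_0)$ at $t=t_0$ and an open neighborhood $B\subset M$ of $\mu$ such that the solution starting at $(q_0,p_0,x_0,y_0)$ at time $t_0$ remains in $M\setminus B$ for all $t\geqslant t_0$ in its maximal interval of existence.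
   Context: $\mathrm{Lip}(\mathbb{R}^5,\mathbb{R})$ denotes the set of functions $u\colon\mathbb{R}^5\to\mathbb{R}$, $u=u(q,p,x,y,t)$, that are continuous and locally Lipschitz (i.e. Lipschitz on every compact $K\subset\mathbb{R}^5$) in all variables except $t$. No periodicity in $q$ or $t$ is assumed. The system describes an inverted pendulum of unit mass and length, in a gravity field with unit acceleration, on a cart of mass $m$ moving along a horizontal line. Here $x$ is the coordinate of the pivot point, $y$ its velocity, $q$ the angle of the rod ($q=0,\pi$ horizontal, $q=\pi/2$ vertical upward), $p$ its angular velocity, and $u$ the horizontal force applied to the cart. The phase space is $\mathbb{R}^4$. An equilibrium $\mu$ is a point of the phase space at which the right-hand side of the system vanishes for all $t$. The derivative of $V$ along the system is $\dot V=\langle\nabla V,F(\cdot,t)\rangle$, where $F$ is the right-hand side of the system. *)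

theory Defs
  imports "HOL-Analysis.Analysis"
begin

type_synonym state = "real \<times> real \<times> real \<times> real"

text \<open>
  The class \<open>Lip(R\<^sup>5, R)\<close>: jointly continuous functions that are Lipschitz in \<open>(q, p, x, y)\<close> on
  every compact set \<open>K\<close> of \<open>R\<^sup>5\<close>, with a constant that depends on \<open>K\<close> only, not on \<open>t\<close>.
\<close>
definition Lip :: "(real \<times> real \<times> real \<times> real \<times> real \<Rightarrow> real) set" where
  "Lip = {u. continuous_on UNIV u \<and>
     (\<forall>K. compact K \<longrightarrow>
       (\<exists>L. \<forall>t. L-lipschitz_on {(q, p, x, y). (q, p, x, y, t) \<in> K}
                   (\<lambda>(q, p, x, y). u (q, p, x, y, t))))}"

definition cart_pendulum ::
  "real \<Rightarrow> (real \<times> real \<times> real \<times> real \<times> real \<Rightarrow> real) \<Rightarrow> real \<Rightarrow> state \<Rightarrow> state" where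
  "cart_pendulum m u t = (\<lambda>(q, p, x, y).
     (p,
      (u (q, p, x, y, t) * sin q + p\<^sup>2 * sin q * cos q - (1 + m) * cos q) / (m + (cos q)\<^sup>2),
      y,
      (u (q, p, x, y, t) + p\<^sup>2 * cos q - sin q * cos q) / (m + (cos q)\<^sup>2)))"

definition above_horizontal :: "state set" where
  "above_horizontal = {(q, p, x, y). 0 < q \<and> q < pi}"

definition equilibrium :: "(real \<Rightarrow> 'a::real_normed_vector \<Rightarrow> 'a) \<Rightarrow> 'a \<Rightarrow> bool" where
  "equilibrium F \<mu> \<longleftrightarrow> (\<forall>t. F t \<mu> = 0)"

text \<open>
  \<open>V\<close> is a \<open>C\<^sup>1\<close> function on \<open>U\<close> with gradient \<open>G\<close>. The set \<open>U\<close> need not be open, and only the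
  values of \<open>V\<close> on \<open>U\<close> matter: derivatives are taken within \<open>U\<close>, which is the ordinary derivative
  at interior points. Every function with a \<open>C\<^sup>1\<close> extension to a neighbourhood of \<open>U\<close> qualifies, with
  \<open>G\<close> the gradient of the extension. At boundary points where the derivative within \<open>U\<close> is not
  unique, \<open>G\<close> records the choice that is made.
\<close>
definition C1_on_with_gradient ::
  "'a::real_inner set \<Rightarrow> ('a \<Rightarrow> real) \<Rightarrow> ('a \<Rightarrow> 'a) \<Rightarrow> bool" where
  "C1_on_with_gradient U V G \<longleftrightarrow>
     (\<forall>z\<in>U. (V has_derivative (\<lambda>h. G z \<bullet> h)) (at z within U)) \<and> continuous_on U G"

definition derivative_along ::
  "(real \<Rightarrow> 'a::real_inner \<Rightarrow> 'a) \<Rightarrow> ('a \<Rightarrow> 'a) \<Rightarrow> real \<Rightarrow> 'a \<Rightarrow> real" where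
  "derivative_along F G t z = G z \<bullet> F t z"

definition solution_on ::
  "(real \<Rightarrow> 'a::real_normed_vector \<Rightarrow> 'a) \<Rightarrow> real set \<Rightarrow> (real \<Rightarrow> 'a) \<Rightarrow> bool" where
  "solution_on F J \<phi> \<longleftrightarrow> open J \<and> is_interval J \<and>
     (\<forall>t\<in>J. (\<phi> has_vector_derivative F t (\<phi> t)) (at t))"

text \<open>
  \<open>\<phi>\<close>, considered on \<open>J\<close> only, is a solution with \<open>\<phi> t\<^sub>0 = z\<^sub>0\<close> that cannot be extended to a larger
  interval, so \<open>J\<close> is its maximal interval of existence in the whole phase space.
\<close>
definition maximal_solution ::
  "(real \<Rightarrow> 'a::real_normed_vector \<Rightarrow> 'a) \<Rightarrow> real \<Rightarrow> 'a \<Rightarrow> real set \<Rightarrow> (real \<Rightarrow> 'a) \<Rightarrow> bool" where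
  "maximal_solution F t\<^sub>0 z\<^sub>0 J \<phi> \<longleftrightarrow>
     t\<^sub>0 \<in> J \<and> \<phi> t\<^sub>0 = z\<^sub>0 \<and> solution_on F J \<phi> \<and>
     (\<forall>J' \<psi>. solution_on F J' \<psi> \<and> J \<subseteq> J' \<and> (\<forall>t\<in>J. \<psi> t = \<phi> t) \<longrightarrow> J' = J)"

end

theory Submission
  imports Defs
begin

text \<open>
  At \<open>q = 0\<close> the angular acceleration is \<open>-1\<close> and at \<open>q = \<pi>\<close> it is \<open>1\<close>, whatever the control is, so
  a trajectory can leave the strip \<open>0 < q < \<pi>\<close> only transversally. Hence the initial states that fall
  over to the left and those that fall over to the right both form open sets. By the Lyapunov
  function, a small sublevel set \<open>B\<close> around \<open>\<mu>\<close> is forward invariant, and so the states that reach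
  \<open>B\<close> without leaving the strip form an open set disjoint from these two. A segment of initial
  states that begins with a fall to the left and ends with a fall to the right is connected, so
  some point of it has none of the three fates: its trajectory stays in the strip and avoids \<open>B\<close>.
\<close>

section \<open>Ordinary differential equations with Lipschitz right-hand side\<close>

text \<open>Since the force is arbitrary, a trajectory may blow up in finite time. Continuous
  dependence is therefore proved only along a compact time interval on which a reference solution is
  known, and each of the three fates is decided at a finite time. Touching q = 0 is not visibly an
  open condition, so a fall is recorded only once q < 0 strictly; the field is defined beyond the
  strip, which gives this a meaning. Touching does lead to crossing: q = 0, q' = 0, q'' = -1 would
  put q below 0 just before the contact, so a trajectory arriving from inside has q' < 0. The side q
  = pi is the mirror image. The neighbourhood \<open>B\<close> must be forward invariant, not merely
  visited: a trajectory that entered \<open>B\<close> and fell over later would have two fates, and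
  the open sets would overlap.\<close>

lemma bounded_vector_derivative_imp_lipschitz:
  fixes f :: "real \<Rightarrow> 'a::real_normed_vector"
  assumes "convex S"
    and "\<And>t. t \<in> S \<Longrightarrow> (f has_vector_derivative f' t) (at t within S)"
    and "\<And>t. t \<in> S \<Longrightarrow> norm (f' t) \<le> B"
    and "s \<in> S" "t \<in> S"
  shows "norm (f t - f s) \<le> B * \<bar>t - s\<bar>"
proof -
  have "norm (f t - f s) \<le> B * norm (t - s)"
  proof (rule differentiable_bound[OF \<open>convex S\<close>])
    show "(f has_derivative (\<lambda>h. h *\<^sub>R f' x)) (at x within S)" if "x \<in> S" for x
      using assms(2)[OF that] by (simp add: has_vector_derivative_def)
    show "onorm (\<lambda>h. h *\<^sub>R f' x) \<le> B" if "x \<in> S" for x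
      using assms(3)[OF that] by (intro onorm_le) (simp add: mult_right_mono mult.commute[of "norm (f' x)"]
         mult.commute[of B] mult_left_mono)
  qed (use assms in auto)
  then show ?thesis by simp
qed

section \<open>Existence for globally Lipschitz fields\<close>

lemma solution_exists_short:
  fixes F :: "real \<Rightarrow> 'a::euclidean_space \<Rightarrow> 'a"
  assumes cont: "continuous_on ({a..b} \<times> UNIV) (\<lambda>(t, z). F t z)"
    and lip: "\<And>t. t \<in> {a..b} \<Longrightarrow> L-lipschitz_on UNIV (F t)"
    and short: "(b - a) * L \<le> 1 / 2"
    and t0: "t\<^sub>0 \<in> {a..b}"
  obtains \<phi> where "\<phi> t\<^sub>0 = z\<^sub>0"
    "\<And>t. t \<in> {a..b} \<Longrightarrow> (\<phi> has_vector_derivative F t (\<phi> t)) (at t within {a..b})"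
proof -
  have ab: "a \<le> b" using t0 by auto
  define I where "I g t = integral {a..t} (\<lambda>s. F s (g s))" for g t
  have cF: "continuous_on {a..b} (\<lambda>s. F s (g s))" if "continuous_on {a..b} g" for g
  proof -
    have "continuous_on {a..b} (\<lambda>s. (s, g s))"
      using that by (intro continuous_on_Pair continuous_on_id)
    from continuous_on_compose2[OF cont this] show ?thesis by auto
  qed
  have dI: "(I g has_vector_derivative F t (g t)) (at t within {a..b})"
    if "continuous_on {a..b} g" "t \<in> {a..b}" for g t
    unfolding I_def using integral_has_vector_derivative[OF cF[OF that(1)] that(2)] .
  have cI: "continuous_on {a..b} (I g)" if "continuous_on {a..b} g" for g
    using dI[OF that] by (meson continuous_on_eq_continuous_within has_vector_derivative_continuous)
  \<comment> \<open>The integral from \<open>t\<^sub>0\<close> is written as a difference of two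
    integrals from \<open>a\<close>, so \<open>t\<^sub>0\<close> may lie anywhere in the interval
    and no reversed integral occurs.\<close>
  define P where "P g t = z\<^sub>0 + I g t - I g t\<^sub>0" for g t
  \<comment> \<open>Clamping the argument extends \<open>P g\<close> to a bounded continuous
    function on the whole line, so Banach's theorem applies in a complete space; the values outside
    \<open>{a..b}\<close> carry no information.\<close>
  have "\<exists>h :: real \<Rightarrow>\<^sub>C 'a. \<forall>t. apply_bcontfun h t = P (apply_bcontfun g) (clamp a b t)" for g :: "real \<Rightarrow>\<^sub>C 'a"
  proof -
    have "continuous_on (cbox a b) (P (apply_bcontfun g))"
      unfolding P_def using cI[of "apply_bcontfun g"] by (auto intro!: continuous_intros)
    then show ?thesis by (meson continuous_on_cbox_bcontfunE)
  qed
  then obtain T :: "(real \<Rightarrow>\<^sub>C 'a) \<Rightarrow> (real \<Rightarrow>\<^sub>C 'a)"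
    where T: "\<And>g t. apply_bcontfun (T g) t = P (apply_bcontfun g) (clamp a b t)"
    by metis
  have L0: "L \<ge> 0" using lip[OF t0] by (rule lipschitz_on_nonneg)
  have "dist (T g) (T h) \<le> 1 / 2 * dist g h" for g h
  proof (rule dist_bound)
    fix t
    let ?t = "clamp a b t"
    have t: "?t \<in> {a..b}" using clamp_in_interval[of a b t] ab by auto
    \<comment> \<open>The mean value estimate bounds the difference by \<open>L * dist g h\<close>
      times the elapsed time; the shortness hypothesis turns this into the contraction factor
      1/2.\<close>
    have "norm ((I g ?t - I h ?t) - (I g t\<^sub>0 - I h t\<^sub>0)) \<le> (L * dist g h) * \<bar>?t - t\<^sub>0\<bar>"
    proof (rule bounded_vector_derivative_imp_lipschitz[where S = "{a..b}"
            and f' = "\<lambda>t. F t (g t) - F t (h t)" and f = "\<lambda>t. I g t - I h t"])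
      show "((\<lambda>t. I g t - I h t) has_vector_derivative F s (g s) - F s (h s)) (at s within {a..b})"
        if "s \<in> {a..b}" for s
        by (intro has_vector_derivative_diff dI that) auto
      show "norm (F s (g s) - F s (h s)) \<le> L * dist g h" if "s \<in> {a..b}" for s
        using lipschitz_on_normD[OF lip[OF that], of "g s" "h s"]
          mult_left_mono[OF dist_bounded[of g s h] L0] by (simp add: dist_norm)
    qed (use t t0 in auto)
    also have "\<dots> \<le> (L * dist g h) * (b - a)"
      using t t0 L0 by (intro mult_left_mono) auto
    also have "\<dots> = ((b - a) * L) * dist g h" by simp
    also have "\<dots> \<le> 1 / 2 * dist g h" using short by (intro mult_right_mono) auto
    finally show "dist (T g t) (T h t) \<le> 1 / 2 * dist g h"
      by (simp add: T P_def dist_norm algebra_simps)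
  qed
  then obtain g where g: "T g = g"
    using banach_fix_type[of "1/2" T] by auto
  have gP: "apply_bcontfun g t = P g t" if "t \<in> {a..b}" for t
    using T[of g t] that by (simp add: g)
  show thesis
  proof
    show "g t\<^sub>0 = z\<^sub>0" using gP[OF t0] by (simp add: P_def)
    show "(apply_bcontfun g has_vector_derivative F t (g t)) (at t within {a..b})"
      if "t \<in> {a..b}" for t
    proof (rule has_vector_derivative_transform[OF that gP])
      show "(P g has_vector_derivative F t (g t)) (at t within {a..b})"
        unfolding P_def[abs_def] using dI[OF _ that, of g]
        by (auto intro!: derivative_eq_intros)
    qed
  qed
qed

text \<open>At the junction the two one-sided derivatives agree, because each is the value of the
  same field at the common point.\<close>

lemma has_vector_derivative_glue:
  fixes f g :: "real \<Rightarrow> 'a::real_normed_vector"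
  assumes c: "a \<le> c" "c \<le> b"
    and f: "\<And>t. t \<in> {a..c} \<Longrightarrow> (f has_vector_derivative F t (f t)) (at t within {a..c})"
    and g: "\<And>t. t \<in> {c..b} \<Longrightarrow> (g has_vector_derivative F t (g t)) (at t within {c..b})"
    and eq: "f c = g c"
    and t: "t \<in> {a..b}"
  defines "h \<equiv> \<lambda>t. if t \<in> {a..c} then f t else g t"
  shows "(h has_vector_derivative F t (h t)) (at t within {a..b})"
proof -
  have "((\<lambda>x. if x \<in> {a..c} then f x else g x) has_vector_derivative
          (if t \<in> {a..c} then F t (f t) else F t (g t))) (at t within {a..b})"
  proof (rule has_vector_derivative_If_within_closures[where T = "{c..b}"])
    have *: "{a..c} \<union> (closure {a..c} \<inter> closure {c..b}) = {a..c}"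
       "{c..b} \<union> (closure {a..c} \<inter> closure {c..b}) = {c..b}" using c by auto
    show "(f has_vector_derivative F t (f t)) (at t within {a..c} \<union> (closure {a..c} \<inter> closure {c..b}))"
      if "t \<in> {a..c} \<union> (closure {a..c} \<inter> closure {c..b})"
      using that f unfolding * by blast
    show "(g has_vector_derivative F t (g t)) (at t within {c..b} \<union> (closure {a..c} \<inter> closure {c..b}))"
      if "t \<in> {c..b} \<union> (closure {a..c} \<inter> closure {c..b})"
      using that g unfolding * by blast
    have "t = c" if "t \<in> closure {a..c}" "t \<in> closure {c..b}"
      using that by auto
    then show "f t = g t" "F t (f t) = F t (g t)" if "t \<in> closure {a..c}" "t \<in> closure {c..b}"
      using that eq by metis+
  qed (use c t in auto)
  then show ?thesis unfolding h_def by (cases "t \<in> {a..c}") (simp_all only: if_True if_False)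
qed

text \<open>The contraction needs a short interval, so the interval is bisected repeatedly. The half
  containing the initial time is solved first, and its value at the midpoint is the initial value
  for the other half. With a global Lipschitz constant the admissible length does not shrink along
  the way.\<close>

lemma solution_exists_Lipschitz:
  fixes F :: "real \<Rightarrow> 'a::euclidean_space \<Rightarrow> 'a"
  assumes cont: "continuous_on ({a..b} \<times> UNIV) (\<lambda>(t, z). F t z)"
    and lip: "\<And>t. t \<in> {a..b} \<Longrightarrow> L-lipschitz_on UNIV (F t)"
    and t0: "t\<^sub>0 \<in> {a..b}"
  obtains \<phi> where "\<phi> t\<^sub>0 = z\<^sub>0"
    "\<And>t. t \<in> {a..b} \<Longrightarrow> (\<phi> has_vector_derivative F t (\<phi> t)) (at t within {a..b})"
proof -
  have *: "\<exists>\<phi>. \<phi> t\<^sub>0 = z\<^sub>0 \<and> (\<forall>t\<in>{a'..b'}. (\<phi> has_vector_derivative F t (\<phi> t)) (at t within {a'..b'}))"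
    if "t\<^sub>0 \<in> {a'..b'}" "{a'..b'} \<subseteq> {a..b}" "(b' - a') * L \<le> 2 ^ n * (1 / 2)" for n a' b' t\<^sub>0 z\<^sub>0
    using that
  proof (induction n arbitrary: a' b' t\<^sub>0 z\<^sub>0)
    case 0
    have "continuous_on ({a'..b'} \<times> UNIV) (\<lambda>(t, z). F t z)"
      using "0.prems" by (intro continuous_on_subset[OF cont]) auto
    then show ?case
      by (rule solution_exists_short[where t\<^sub>0 = t\<^sub>0 and z\<^sub>0 = z\<^sub>0 and L = L])
         (use "0.prems" lip in auto)
  next
    case (Suc n)
    define c where "c = (a' + b') / 2"
    have c: "a' \<le> c" "c \<le> b'" using Suc.prems by (auto simp: c_def)
    have half: "(b' - c) * L \<le> 2 ^ n * (1 / 2)" "(c - a') * L \<le> 2 ^ n * (1 / 2)"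
      using Suc.prems(3) by (simp_all add: c_def field_simps)
    have sub: "{a'..c} \<subseteq> {a..b}" "{c..b'} \<subseteq> {a..b}" using c Suc.prems by auto
    show ?case
    proof (cases "t\<^sub>0 \<le> c")
      case True
      then obtain f where f: "f t\<^sub>0 = z\<^sub>0" "\<forall>t\<in>{a'..c}. (f has_vector_derivative F t (f t)) (at t within {a'..c})"
        using Suc.IH[OF _ sub(1) half(2), of t\<^sub>0 z\<^sub>0] Suc.prems by auto
      obtain g where g: "g c = f c" "\<forall>t\<in>{c..b'}. (g has_vector_derivative F t (g t)) (at t within {c..b'})"
        using Suc.IH[OF _ sub(2) half(1), of c "f c"] c by auto
      show ?thesis
        using has_vector_derivative_glue[of a' c b' f F g] f g c True Suc.prems
        by (intro exI[of _ "\<lambda>t. if t \<in> {a'..c} then f t else g t"]) auto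
    next
      case False
      then obtain g where g: "g t\<^sub>0 = z\<^sub>0" "\<forall>t\<in>{c..b'}. (g has_vector_derivative F t (g t)) (at t within {c..b'})"
        using Suc.IH[OF _ sub(2) half(1), of t\<^sub>0 z\<^sub>0] Suc.prems by auto
      obtain f where f: "f c = g c" "\<forall>t\<in>{a'..c}. (f has_vector_derivative F t (f t)) (at t within {a'..c})"
        using Suc.IH[OF _ sub(1) half(2), of c "g c"] c by auto
      show ?thesis
        using has_vector_derivative_glue[of a' c b' f F g] f g c False Suc.prems
        by (intro exI[of _ "\<lambda>t. if t \<in> {a'..c} then f t else g t"]) auto
    qed
  qed
  obtain n where "(b - a) * L * 2 < 2 ^ n"
    using real_arch_pow[of 2 "(b - a) * L * 2"] by auto
  then show thesis
    using *[of t\<^sub>0 a b n z\<^sub>0] t0 that by auto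
qed

text \<open>
  Gronwall's inequality, forwards and backwards in time: \<open>exp (-2 L t) |\<phi> t - \<psi> t|\<^sup>2\<close> is
  nonincreasing and \<open>exp (2 L t) |\<phi> t - \<psi> t|\<^sup>2\<close> is nondecreasing.
\<close>
lemma solutions_dist_le:
  fixes F :: "real \<Rightarrow> 'a::real_inner \<Rightarrow> 'a"
  assumes ab: "a \<le> b"
    and lip: "\<And>t. t \<in> {a..b} \<Longrightarrow> L-lipschitz_on S (F t)"
    and \<phi>: "\<And>t. t \<in> {a..b} \<Longrightarrow> (\<phi> has_vector_derivative F t (\<phi> t)) (at t within {a..b})"
    and \<psi>: "\<And>t. t \<in> {a..b} \<Longrightarrow> (\<psi> has_vector_derivative F t (\<psi> t)) (at t within {a..b})"
    and S: "\<phi> ` {a..b} \<subseteq> S" "\<psi> ` {a..b} \<subseteq> S"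
  shows "dist (\<phi> b) (\<psi> b) \<le> exp (L * (b - a)) * dist (\<phi> a) (\<psi> a)"
    and "dist (\<phi> a) (\<psi> a) \<le> exp (L * (b - a)) * dist (\<phi> b) (\<psi> b)"
proof -
  define w where "w t = (\<phi> t - \<psi> t) \<bullet> (\<phi> t - \<psi> t)" for t
  define w' where "w' t = 2 * ((\<phi> t - \<psi> t) \<bullet> (F t (\<phi> t) - F t (\<psi> t)))" for t
  have w: "(w has_real_derivative w' t) (at t within {a..b})" if "t \<in> {a..b}" for t
    unfolding w_def[abs_def] w'_def has_real_derivative_iff_has_vector_derivative
    using \<phi>[OF that] \<psi>[OF that]
    by (auto intro!: derivative_eq_intros simp: has_vector_derivative_def inner_commute algebra_simps)
  have w': "\<bar>w' t\<bar> \<le> 2 * L * w t" if "t \<in> {a..b}" for t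
  proof -
    have "\<bar>w' t\<bar> \<le> 2 * (norm (\<phi> t - \<psi> t) * norm (F t (\<phi> t) - F t (\<psi> t)))"
      unfolding w'_def using Cauchy_Schwarz_ineq2 by (auto simp: abs_mult)
    also have "\<dots> \<le> 2 * (norm (\<phi> t - \<psi> t) * (L * norm (\<phi> t - \<psi> t)))"
      using S that by (intro mult_left_mono lipschitz_on_normD[OF lip]) auto
    also have "\<dots> = 2 * L * w t" by (simp add: w_def dot_square_norm power2_eq_square)
    finally show ?thesis .
  qed
  have cw: "continuous_on {a..b} w"
    using w by (meson DERIV_continuous continuous_on_eq_continuous_within)
  have wD: "(w has_real_derivative w' t) (at t)" if "a < t" "t < b" for t
    using w[of t] that by (simp add: at_within_Icc_at)
  have "exp (-2 * L * b) * w b \<le> exp (-2 * L * a) * w a"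
  proof (rule DERIV_nonpos_imp_decreasing_open[OF ab])
    fix t assume t: "a < t" "t < b"
    have "((\<lambda>t. exp (-2 * L * t) * w t) has_real_derivative exp (-2 * L * t) * (w' t - 2 * L * w t)) (at t)"
      by (auto intro!: derivative_eq_intros wD t simp: algebra_simps)
    moreover have "exp (-2 * L * t) * (w' t - 2 * L * w t) \<le> 0"
      using w'[of t] t by (intro mult_nonneg_nonpos) auto
    ultimately show "\<exists>y. ((\<lambda>t. exp (-2 * L * t) * w t) has_real_derivative y) (at t) \<and> y \<le> 0"
      by blast
  qed (auto intro!: continuous_intros cw)
  moreover have "exp (2 * L * a) * w a \<le> exp (2 * L * b) * w b"
  proof (rule DERIV_nonneg_imp_increasing_open[OF ab])
    fix t assume t: "a < t" "t < b"
    have "((\<lambda>t. exp (2 * L * t) * w t) has_real_derivative exp (2 * L * t) * (w' t + 2 * L * w t)) (at t)"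
      by (auto intro!: derivative_eq_intros wD t simp: algebra_simps)
    moreover have "exp (2 * L * t) * (w' t + 2 * L * w t) \<ge> 0"
      using w'[of t] t by (intro mult_nonneg_nonneg) auto
    ultimately show "\<exists>y. ((\<lambda>t. exp (2 * L * t) * w t) has_real_derivative y) (at t) \<and> 0 \<le> y"
      by blast
  qed (auto intro!: continuous_intros cw)
  ultimately have "w b \<le> (exp (L * (b - a)))\<^sup>2 * w a" "w a \<le> (exp (L * (b - a)))\<^sup>2 * w b"
    by (auto simp: exp_minus exp_diff field_simps power2_eq_square simp flip: exp_add)
  moreover have "w t = (dist (\<phi> t) (\<psi> t))\<^sup>2" for t
    by (simp add: w_def dist_norm dot_square_norm)
  ultimately have "(dist (\<phi> b) (\<psi> b))\<^sup>2 \<le> (exp (L * (b - a)) * dist (\<phi> a) (\<psi> a))\<^sup>2"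
    "(dist (\<phi> a) (\<psi> a))\<^sup>2 \<le> (exp (L * (b - a)) * dist (\<phi> b) (\<psi> b))\<^sup>2"
    by (simp_all add: power_mult_distrib)
  then show "dist (\<phi> b) (\<psi> b) \<le> exp (L * (b - a)) * dist (\<phi> a) (\<psi> a)"
    "dist (\<phi> a) (\<psi> a) \<le> exp (L * (b - a)) * dist (\<phi> b) (\<psi> b)"
    by (auto intro: power2_le_imp_le)
qed

section \<open>Locally Lipschitz fields\<close>

lemma solution_on_within:
  assumes "solution_on F J \<phi>" "{a..b} \<subseteq> J" "t \<in> {a..b}"
  shows "(\<phi> has_vector_derivative F t (\<phi> t)) (at t within {a..b})"
  using assms unfolding solution_on_def
  by (meson has_vector_derivative_at_within subsetD)

lemma solution_on_continuous:
  assumes "solution_on F J \<phi>"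
  shows "continuous_on J \<phi>"
  using assms unfolding solution_on_def
  by (meson continuous_at_imp_continuous_on has_vector_derivative_continuous)

lemma is_interval_atLeastAtMost_subset:
  fixes J :: "real set"
  assumes "is_interval J" "a \<in> J" "b \<in> J"
  shows "{a..b} \<subseteq> J"
  using assms unfolding is_interval_1 by (meson atLeastAtMost_iff subsetI)

text \<open>Balls serve as the compact sets because they are convex: the nearest-point projection
  onto a ball does not increase distances, so a field truncated by it keeps its Lipschitz
  constant.\<close>

locale locally_Lipschitz_ode =
  fixes F :: "real \<Rightarrow> 'a::euclidean_space \<Rightarrow> 'a"
  assumes continuous_field: "continuous_on UNIV (\<lambda>(t, z). F t z)"
    and Lipschitz_field: "\<exists>L. \<forall>t\<in>{a..b}. L-lipschitz_on (cball 0 R) (F t)"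
begin

text \<open>Between \<open>s\<close> and \<open>t\<close> both orbits lie in one ball, hence share a
  Lipschitz constant. Gronwall's inequality with distance 0 at one end is needed in both time
  directions, as \<open>t\<close> may precede \<open>s\<close>.\<close>

lemma solution_unique:
  assumes \<phi>: "solution_on F J\<^sub>1 \<phi>" and \<psi>: "solution_on F J\<^sub>2 \<psi>"
    and s: "s \<in> J\<^sub>1 \<inter> J\<^sub>2" "\<phi> s = \<psi> s" and t: "t \<in> J\<^sub>1 \<inter> J\<^sub>2"
  shows "\<phi> t = \<psi> t"
proof -
  define a b where "a = min s t" and "b = max s t"
  have mem: "a \<in> J\<^sub>1" "b \<in> J\<^sub>1" "a \<in> J\<^sub>2" "b \<in> J\<^sub>2"
    using s t by (auto simp: a_def b_def min_def max_def)
  have sub: "{a..b} \<subseteq> J\<^sub>1" "{a..b} \<subseteq> J\<^sub>2"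
    using \<phi> \<psi> mem is_interval_atLeastAtMost_subset by (auto simp: solution_on_def)
  have "compact (\<phi> ` {a..b} \<union> \<psi> ` {a..b})"
    using sub solution_on_continuous[OF \<phi>] solution_on_continuous[OF \<psi>]
    by (intro compact_Un compact_continuous_image) (auto intro: continuous_on_subset)
  then obtain R where R: "\<phi> ` {a..b} \<union> \<psi> ` {a..b} \<subseteq> cball 0 R"
    by (meson ball_subset_cball bounded_subset_ballD compact_imp_bounded order_trans)
  obtain L where L: "\<forall>t\<in>{a..b}. L-lipschitz_on (cball 0 R) (F t)"
    using Lipschitz_field by blast
  have "a \<le> b" by (simp add: a_def b_def)
  note le = solutions_dist_le[OF \<open>a \<le> b\<close> L[rule_format] solution_on_within[OF \<phi> sub(1)]
      solution_on_within[OF \<psi> sub(2)]]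
  have "dist (\<phi> b) (\<psi> b) \<le> exp (L * (b - a)) * dist (\<phi> a) (\<psi> a)"
    "dist (\<phi> a) (\<psi> a) \<le> exp (L * (b - a)) * dist (\<phi> b) (\<psi> b)"
    using R by (auto intro!: le)
  then show ?thesis
    using s(2) by (cases "s \<le> t") (auto simp: a_def b_def)
qed

text \<open>
  Continuous dependence on the initial value: the field is replaced by its composition with the
  projection to a large ball, whose solutions do not blow up. For \<open>T = t\<^sub>0\<close> the statement contains
  the local existence of solutions.
\<close>
lemma solution_near:
  assumes le: "t\<^sub>0 \<le> T"
    and \<phi>: "\<And>t. t \<in> {t\<^sub>0..T} \<Longrightarrow> (\<phi> has_vector_derivative F t (\<phi> t)) (at t within {t\<^sub>0..T})"
    and e: "e > 0"
  obtains d where "d > 0"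
    "\<And>z. dist z (\<phi> t\<^sub>0) < d \<Longrightarrow> \<exists>J \<psi>. solution_on F J \<psi> \<and> {t\<^sub>0..T} \<subseteq> J \<and> \<psi> t\<^sub>0 = z \<and>
       (\<forall>t\<in>{t\<^sub>0..T}. dist (\<phi> t) (\<psi> t) < e)"
proof -
  have "continuous_on {t\<^sub>0..T} \<phi>"
    using \<phi> by (meson continuous_on_eq_continuous_within has_vector_derivative_continuous)
  then have "compact (\<phi> ` {t\<^sub>0..T})" by (intro compact_continuous_image) auto
  then obtain r where r: "r > 0" "\<phi> ` {t\<^sub>0..T} \<subseteq> ball 0 r"
    by (meson bounded_subset_ballD compact_imp_bounded)
  \<comment> \<open>The margin 1 matches the bound \<open>min e 1\<close> below: a solution that
    close to \<open>\<phi>\<close> stays in the ball, where the truncated field is the original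
    one.\<close>
  define R where "R = r + 1"
  define C :: "'a set" where "C = cball 0 R"
  \<comment> \<open>A unit of time at either end leaves room for the open interval that
    \<open>solution_on\<close> demands.\<close>
  define a b where "a = t\<^sub>0 - 1" and "b = T + 1"
  have C: "convex C" "closed C" "C \<noteq> {}" using r by (auto simp: C_def R_def)
  obtain L where L: "\<And>t. t \<in> {a..b} \<Longrightarrow> L-lipschitz_on C (F t)"
    using Lipschitz_field[of a b R] unfolding C_def by blast
  have L0: "L \<ge> 0" using L[of a] le by (auto simp: a_def b_def intro: lipschitz_on_nonneg)
  define F' where "F' t z = F t (closest_point C z)" for t z
  have F'_eq: "F' t z = F t z" if "z \<in> C" for t z
    using that by (simp add: F'_def closest_point_self)
  have lip': "L-lipschitz_on UNIV (F' t)" if "t \<in> {a..b}" for t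
  proof (rule lipschitz_onI)
    fix x y
    have "dist (F' t x) (F' t y) \<le> L * dist (closest_point C x) (closest_point C y)"
      unfolding F'_def using C by (intro lipschitz_onD[OF L[OF that]] closest_point_in_set) auto
    also have "\<dots> \<le> L * dist x y"
      using C by (intro mult_left_mono closest_point_lipschitz L0)
    finally show "dist (F' t x) (F' t y) \<le> L * dist x y" .
  qed (rule L0)
  have "continuous_on ({a..b} \<times> UNIV) (\<lambda>p. (fst p, closest_point C (snd p)))"
    by (intro continuous_intros continuous_on_compose2[OF continuous_on_closest_point[OF C, of UNIV]]) auto
  from continuous_on_compose2[OF continuous_field this]
  have cont': "continuous_on ({a..b} \<times> UNIV) (\<lambda>(t, z). F' t z)"
    by (auto simp: F'_def case_prod_unfold)
  define E where "E = exp (L * (T - t\<^sub>0))"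
  have E: "E > 0" by (simp add: E_def)
  \<comment> \<open>\<open>E\<close> is the Gronwall factor over the whole interval, and bounds the
    factors for all earlier times.\<close>
  define d where "d = min e 1 / E"
  show thesis
  proof
    show "d > 0" using e E by (simp add: d_def)
    fix z assume z: "dist z (\<phi> t\<^sub>0) < d"
    have "t\<^sub>0 \<in> {a..b}" using le by (auto simp: a_def b_def)
    then obtain \<psi> where \<psi>0: "\<psi> t\<^sub>0 = z"
      and \<psi>: "\<And>t. t \<in> {a..b} \<Longrightarrow> (\<psi> has_vector_derivative F' t (\<psi> t)) (at t within {a..b})"
      using solution_exists_Lipschitz[OF cont' lip'] by blast
    have near: "dist (\<phi> t) (\<psi> t) < min e 1" if t: "t \<in> {t\<^sub>0..T}" for t
    proof -
      have "(\<phi> has_vector_derivative F' s (\<phi> s)) (at s within {t\<^sub>0..t})" if "s \<in> {t\<^sub>0..t}" for s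
      proof -
        have "\<phi> s \<in> C" using r that t by (force simp: C_def R_def)
        with \<phi>[of s] that t show ?thesis
          by (auto simp: F'_eq intro: has_vector_derivative_within_subset)
      qed
      moreover have "(\<psi> has_vector_derivative F' s (\<psi> s)) (at s within {t\<^sub>0..t})" if "s \<in> {t\<^sub>0..t}" for s
        using \<psi>[of s] that t
        by (auto simp: a_def b_def intro: has_vector_derivative_within_subset)
      moreover have "L-lipschitz_on UNIV (F' s)" if "s \<in> {t\<^sub>0..t}" for s
        using that t by (intro lip') (auto simp: a_def b_def)
      ultimately have "dist (\<phi> t) (\<psi> t) \<le> exp (L * (t - t\<^sub>0)) * dist (\<phi> t\<^sub>0) (\<psi> t\<^sub>0)"
        using t by (intro solutions_dist_le(1)[where S = UNIV and F = F']) auto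
      also have "\<dots> \<le> E * dist (\<phi> t\<^sub>0) (\<psi> t\<^sub>0)"
        unfolding E_def using t L0 by (intro mult_right_mono) (auto intro: mult_left_mono)
      also have "\<dots> < E * d"
        using z E by (simp add: \<psi>0 dist_commute)
      also have "\<dots> = min e 1" using E by (simp add: d_def)
      finally show ?thesis .
    qed
    have \<psi>_cont: "continuous_on {a<..<b} \<psi>"
      using \<psi> by (meson continuous_on_eq_continuous_within continuous_on_subset greaterThanLessThan_subseteq_atLeastAtMost_iff
          has_vector_derivative_continuous order_refl)
    \<comment> \<open>These are times at which the truncation is inactive, so that
      \<open>\<psi>\<close> solves the original equation there. Compactness of
      \<open>{t\<^sub>0..T}\<close> fits an open interval in between.\<close>
    define O' where "O' = {a<..<b} \<inter> \<psi> -` ball 0 R"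
    have O'_open: "open O'"
      unfolding O'_def using \<psi>_cont by (intro continuous_open_preimage) auto
    have O'_sup: "{t\<^sub>0..T} \<subseteq> O'"
    proof
      fix t assume t: "t \<in> {t\<^sub>0..T}"
      have "norm (\<phi> t) < r" using subsetD[OF r(2) imageI[OF t]] by simp
      moreover have "norm (\<psi> t) \<le> norm (\<phi> t) + dist (\<phi> t) (\<psi> t)"
        by (metis add.commute dist_norm norm_minus_commute norm_triangle_sub)
      moreover have "dist (\<phi> t) (\<psi> t) < 1" using near[OF t] by simp
      ultimately have "norm (\<psi> t) < R" by (simp add: R_def)
      then show "t \<in> O'" using t by (auto simp: O'_def a_def b_def)
    qed
    obtain \<epsilon> where \<epsilon>: "\<epsilon> > 0" "(\<Union>t\<in>{t\<^sub>0..T}. ball t \<epsilon>) \<subseteq> O'"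
      by (rule compact_subset_open_imp_ball_epsilon_subset[OF compact_Icc O'_open O'_sup])
    define J where "J = {t\<^sub>0 - \<epsilon><..<T + \<epsilon>}"
    have "J \<subseteq> O'"
    proof
      fix t assume t: "t \<in> J"
      have "dist (max t\<^sub>0 (min t T)) t < \<epsilon>" "max t\<^sub>0 (min t T) \<in> {t\<^sub>0..T}"
        using t \<epsilon>(1) le unfolding J_def dist_real_def by (simp_all, linarith)
      then have "t \<in> (\<Union>t\<in>{t\<^sub>0..T}. ball t \<epsilon>)" by (intro UN_I) simp_all
      then show "t \<in> O'" using \<epsilon>(2) by (rule subsetD[rotated])
    qed
    have "solution_on F J \<psi>"
      unfolding solution_on_def
    proof (intro conjI ballI)
      fix t assume "t \<in> J"
      then have "t \<in> {a<..<b}" "\<psi> t \<in> C" using \<open>J \<subseteq> O'\<close> by (auto simp: O'_def C_def)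
      with \<psi>[of t] show "(\<psi> has_vector_derivative F t (\<psi> t)) (at t)"
        by (simp add: F'_eq at_within_Icc_at)
    qed (auto simp: J_def is_interval_1)
    moreover have "{t\<^sub>0..T} \<subseteq> J" using \<epsilon>(1) by (auto simp: J_def)
    ultimately show "\<exists>J \<psi>. solution_on F J \<psi> \<and> {t\<^sub>0..T} \<subseteq> J \<and> \<psi> t\<^sub>0 = z \<and>
       (\<forall>t\<in>{t\<^sub>0..T}. dist (\<phi> t) (\<psi> t) < e)"
      using \<psi>0 near by (intro exI[of _ J] exI[of _ \<psi>]) simp
  qed
qed

lemma solution_exists:
  obtains J \<phi> where "solution_on F J \<phi>" "t\<^sub>0 \<in> J" "\<phi> t\<^sub>0 = z\<^sub>0"
proof -
  \<comment> \<open>Within a one-point interval any vector is a derivative, so a constant function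
    serves as the reference solution.\<close>
  have "((\<lambda>_. z\<^sub>0) has_vector_derivative F t z\<^sub>0) (at t within {t\<^sub>0..t\<^sub>0})" if "t \<in> {t\<^sub>0..t\<^sub>0}" for t
    using that by (simp add: has_vector_derivative_def has_derivative_within_singleton_iff bounded_linear_scaleR_left)
  from solution_near[OF order_refl this zero_less_one] show thesis
    using that by (metis atLeastAtMost_singleton dist_self insert_subset)
qed

section \<open>Gluing and maximal solutions\<close>

text \<open>Uniqueness makes the pieces agree wherever they overlap, so the index \<open>k t\<close>
  chosen at each time does not affect the value. The union is an interval because all pieces contain
  \<open>t\<^sub>0\<close>.\<close>

lemma solution_on_Union:
  assumes \<phi>: "\<And>i. i \<in> I \<Longrightarrow> solution_on F (J i) (\<phi> i) \<and> t\<^sub>0 \<in> J i \<and> \<phi> i t\<^sub>0 = z\<^sub>0"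
  obtains \<psi> where "solution_on F (\<Union>i\<in>I. J i) \<psi>" "\<And>i t. i \<in> I \<Longrightarrow> t \<in> J i \<Longrightarrow> \<psi> t = \<phi> i t"
proof -
  have "\<exists>k. \<forall>t\<in>(\<Union>i\<in>I. J i). k t \<in> I \<and> t \<in> J (k t)" by (intro bchoice) auto
  then obtain k where k: "\<And>t. t \<in> (\<Union>i\<in>I. J i) \<Longrightarrow> k t \<in> I \<and> t \<in> J (k t)" by blast
  define \<psi> where "\<psi> t = \<phi> (k t) t" for t
  have eq: "\<psi> t = \<phi> i t" if "i \<in> I" "t \<in> J i" for i t
    unfolding \<psi>_def
  proof (rule solution_unique[of "J (k t)" "\<phi> (k t)" "J i" "\<phi> i" t\<^sub>0])
    have "k t \<in> I" "t \<in> J (k t)" using k[of t] that by auto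
    then show "solution_on F (J (k t)) (\<phi> (k t))" "solution_on F (J i) (\<phi> i)"
      "t\<^sub>0 \<in> J (k t) \<inter> J i" "\<phi> (k t) t\<^sub>0 = \<phi> i t\<^sub>0" "t \<in> J (k t) \<inter> J i"
      using \<phi> that by auto
  qed
  have "solution_on F (\<Union>i\<in>I. J i) \<psi>"
    unfolding solution_on_def
  proof (intro conjI ballI)
    show "open (\<Union>i\<in>I. J i)" using \<phi> by (auto simp: solution_on_def)
    have "connected (\<Union>i\<in>I. J i)"
    proof (rule connected_Union)
      show "connected S" if "S \<in> J ` I" for S
        using that \<phi> by (auto simp: solution_on_def is_interval_connected_1)
      have "t\<^sub>0 \<in> \<Inter>(J ` I)" using \<phi> by blast
      then show "\<Inter>(J ` I) \<noteq> {}" by blast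
    qed
    then show "is_interval (\<Union>i\<in>I. J i)" by (simp add: is_interval_connected_1)
    fix t assume "t \<in> (\<Union>i\<in>I. J i)"
    then obtain i where i: "i \<in> I" "t \<in> J i" by blast
    show "(\<psi> has_vector_derivative F t (\<psi> t)) (at t)"
    proof (rule has_vector_derivative_transform_within_open)
      show "(\<phi> i has_vector_derivative F t (\<psi> t)) (at t)" "open (J i)" "t \<in> J i"
        using \<phi> i by (auto simp: solution_on_def eq[OF i])
    qed (use eq i in auto)
  qed
  with eq that show thesis by blast
qed

text \<open>All solutions with the same initial value are compatible, so their union is itself a
  solution and no Zorn argument is required. The family is indexed by the pairs of domain and
  function themselves.\<close>

lemma maximal_solution_exists:
  obtains J \<phi> where "maximal_solution F t\<^sub>0 z\<^sub>0 J \<phi>"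
proof -
  define I where "I = {(J, \<phi>). solution_on F J \<phi> \<and> t\<^sub>0 \<in> J \<and> \<phi> t\<^sub>0 = z\<^sub>0}"
  obtain J\<^sub>0 \<phi>\<^sub>0 where 0: "(J\<^sub>0, \<phi>\<^sub>0) \<in> I"
    unfolding I_def using solution_exists by blast
  obtain \<psi> where \<psi>: "solution_on F (\<Union>i\<in>I. fst i) \<psi>" "\<And>i t. i \<in> I \<Longrightarrow> t \<in> fst i \<Longrightarrow> \<psi> t = snd i t"
    by (rule solution_on_Union[of I fst snd t\<^sub>0 z\<^sub>0]) (auto simp: I_def)
  have t0: "t\<^sub>0 \<in> (\<Union>i\<in>I. fst i)" "\<psi> t\<^sub>0 = z\<^sub>0"
    using 0 \<psi>(2)[OF 0, of t\<^sub>0] by (force simp: I_def)+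
  have "maximal_solution F t\<^sub>0 z\<^sub>0 (\<Union>i\<in>I. fst i) \<psi>"
    unfolding maximal_solution_def
  proof (intro conjI allI impI t0 \<psi>(1))
    fix J' \<xi>
    assume *: "solution_on F J' \<xi> \<and> (\<Union>i\<in>I. fst i) \<subseteq> J' \<and> (\<forall>t\<in>(\<Union>i\<in>I. fst i). \<xi> t = \<psi> t)"
    then have "t\<^sub>0 \<in> J'" "\<xi> t\<^sub>0 = z\<^sub>0" using t0 by (blast, metis)
    with * have "(J', \<xi>) \<in> I" by (simp add: I_def)
    then show "J' = (\<Union>i\<in>I. fst i)" using * by force
  qed
  then show thesis by (rule that)
qed

text \<open>Gluing the two solutions extends the maximal one to \<open>J \<union> J'\<close>, which
  maximality forces to be \<open>J\<close>.\<close>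

lemma maximal_solution_contains:
  assumes max: "maximal_solution F t\<^sub>0 z\<^sub>0 J \<phi>"
    and \<psi>: "solution_on F J' \<psi>" "t\<^sub>0 \<in> J'" "\<psi> t\<^sub>0 = z\<^sub>0"
  shows "J' \<subseteq> J" "t \<in> J' \<Longrightarrow> \<psi> t = \<phi> t"
proof -
  obtain \<xi> where \<xi>: "solution_on F (\<Union>i\<in>{(J, \<phi>), (J', \<psi>)}. fst i) \<xi>"
    "\<And>i t. i \<in> {(J, \<phi>), (J', \<psi>)} \<Longrightarrow> t \<in> fst i \<Longrightarrow> \<xi> t = snd i t"
    by (rule solution_on_Union[of "{(J, \<phi>), (J', \<psi>)}" fst snd t\<^sub>0 z\<^sub>0])
       (use assms in \<open>auto simp: maximal_solution_def\<close>)
  have "\<forall>t\<in>J. \<xi> t = \<phi> t" "\<forall>t\<in>J'. \<xi> t = \<psi> t" using \<xi>(2)[of "(J, \<phi>)"] \<xi>(2)[of "(J', \<psi>)"] by auto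
  moreover have "solution_on F (J \<union> J') \<xi>" using \<xi>(1) by simp
  ultimately have "J \<union> J' = J" using max unfolding maximal_solution_def by blast
  then show "J' \<subseteq> J" by blast
  then show "\<psi> t = \<phi> t" if "t \<in> J'"
    using that \<open>\<forall>t\<in>J. \<xi> t = \<phi> t\<close> \<open>\<forall>t\<in>J'. \<xi> t = \<psi> t\<close> by (metis subsetD)
qed

section \<open>Initial states with a prescribed fate\<close>

text \<open>Any local solution reaching as far as \<open>T\<close> may be the witness, not only the
  maximal one. Openness then needs nearby solutions on \<open>{t\<^sub>0..T}\<close> only, with no
  control over their maximal domains.\<close>

definition reaching_within :: "real \<Rightarrow> 'a set \<Rightarrow> 'a set \<Rightarrow> 'a set" where
  "reaching_within t\<^sub>0 W A = {z. \<exists>J \<phi> T. solution_on F J \<phi> \<and> t\<^sub>0 \<le> T \<and> {t\<^sub>0..T} \<subseteq> J \<and> \<phi> t\<^sub>0 = z \<and>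
     \<phi> ` {t\<^sub>0..T} \<subseteq> W \<and> \<phi> T \<in> A}"

text \<open>The orbit up to \<open>T\<close> is compact, so it keeps a positive distance
  \<open>e1\<close> from the outside of \<open>W\<close>; its endpoint has a margin
  \<open>e2\<close> in \<open>A\<close>. Solutions closer than both margins have the same
  fate.\<close>

lemma open_reaching_within:
  assumes "open W" "open A"
  shows "open (reaching_within t\<^sub>0 W A)"
  unfolding open_dist
proof
  fix z assume "z \<in> reaching_within t\<^sub>0 W A"
  then obtain J \<phi> T where \<phi>: "solution_on F J \<phi>" "t\<^sub>0 \<le> T" "{t\<^sub>0..T} \<subseteq> J" "\<phi> t\<^sub>0 = z"
     "\<phi> ` {t\<^sub>0..T} \<subseteq> W" "\<phi> T \<in> A" by (auto simp: reaching_within_def)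
  have "compact (\<phi> ` {t\<^sub>0..T})"
    using solution_on_continuous[OF \<phi>(1)] \<phi>(3) by (intro compact_continuous_image) (auto intro: continuous_on_subset)
  then obtain e1 where e1: "e1 > 0" "(\<Union>x\<in>\<phi> ` {t\<^sub>0..T}. ball x e1) \<subseteq> W"
    using compact_subset_open_imp_ball_epsilon_subset[OF _ \<open>open W\<close> \<phi>(5)] by blast
  obtain e2 where e2: "e2 > 0" "ball (\<phi> T) e2 \<subseteq> A"
    using \<open>open A\<close> \<phi>(6) by (meson openE)
  obtain d where d: "d > 0"
    "\<And>z. dist z (\<phi> t\<^sub>0) < d \<Longrightarrow> \<exists>J \<psi>. solution_on F J \<psi> \<and> {t\<^sub>0..T} \<subseteq> J \<and> \<psi> t\<^sub>0 = z \<and>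
       (\<forall>t\<in>{t\<^sub>0..T}. dist (\<phi> t) (\<psi> t) < min e1 e2)"
    using solution_near[OF \<phi>(2) solution_on_within[OF \<phi>(1,3)], of "min e1 e2"] e1 e2 by auto
  have "z' \<in> reaching_within t\<^sub>0 W A" if z': "dist z' z < d" for z'
  proof -
    obtain J' \<psi> where \<psi>: "solution_on F J' \<psi>" "{t\<^sub>0..T} \<subseteq> J'" "\<psi> t\<^sub>0 = z'"
       "\<forall>t\<in>{t\<^sub>0..T}. dist (\<phi> t) (\<psi> t) < min e1 e2"
      using d(2)[of z'] z' \<phi>(4) by auto
    have "\<psi> ` {t\<^sub>0..T} \<subseteq> W" using e1(2) \<psi>(4) by fastforce
    moreover have "\<psi> T \<in> A" using e2(2) \<psi>(4) \<phi>(2) by fastforce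
    ultimately show ?thesis using \<psi> \<phi>(2) unfolding reaching_within_def by blast
  qed
  then show "\<exists>e>0. \<forall>y. dist y z < e \<longrightarrow> y \<in> reaching_within t\<^sub>0 W A" using d(1) by blast
qed

lemma reaching_within_iff:
  assumes max: "maximal_solution F t\<^sub>0 z J \<phi>"
  shows "z \<in> reaching_within t\<^sub>0 W A \<longleftrightarrow> (\<exists>T\<in>J. t\<^sub>0 \<le> T \<and> \<phi> ` {t\<^sub>0..T} \<subseteq> W \<and> \<phi> T \<in> A)"
proof
  assume "z \<in> reaching_within t\<^sub>0 W A"
  then obtain J' \<psi> T where \<psi>: "solution_on F J' \<psi>" "t\<^sub>0 \<le> T" "{t\<^sub>0..T} \<subseteq> J'" "\<psi> t\<^sub>0 = z"
     "\<psi> ` {t\<^sub>0..T} \<subseteq> W" "\<psi> T \<in> A" by (auto simp: reaching_within_def)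
  then have "t\<^sub>0 \<in> J'" by auto
  note contains = maximal_solution_contains[OF max \<psi>(1) this \<psi>(4)]
  have eq: "\<psi> t = \<phi> t" if "t \<in> {t\<^sub>0..T}" for t using contains(2)[of t] \<psi>(3) that by blast
  have "T \<in> J" using contains(1) \<psi>(2,3) by auto
  moreover have "\<phi> ` {t\<^sub>0..T} \<subseteq> W" using \<psi>(5) eq by auto
  moreover have "\<phi> T \<in> A" using \<psi>(2,6) eq[of T] by auto
  ultimately show "\<exists>T\<in>J. t\<^sub>0 \<le> T \<and> \<phi> ` {t\<^sub>0..T} \<subseteq> W \<and> \<phi> T \<in> A" using \<psi>(2) by blast
next
  assume "\<exists>T\<in>J. t\<^sub>0 \<le> T \<and> \<phi> ` {t\<^sub>0..T} \<subseteq> W \<and> \<phi> T \<in> A"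
  then obtain T where T: "T \<in> J" "t\<^sub>0 \<le> T" "\<phi> ` {t\<^sub>0..T} \<subseteq> W" "\<phi> T \<in> A" by blast
  have "{t\<^sub>0..T} \<subseteq> J"
    using max T(1) by (intro is_interval_atLeastAtMost_subset) (auto simp: maximal_solution_def solution_on_def)
  then show "z \<in> reaching_within t\<^sub>0 W A"
    using max T unfolding reaching_within_def maximal_solution_def by blast
qed

end

section \<open>The pendulum field is locally Lipschitz\<close>

text \<open>Boundedness is carried along because Lipschitz continuity alone does not survive
  products. Both constants are uniform in \<open>t\<close>, as the locale requires of the Lipschitz
  constant.\<close>

definition uniformly_Lipschitz_bounded ::
  "'t set \<Rightarrow> 'a::metric_space set \<Rightarrow> ('t \<Rightarrow> 'a \<Rightarrow> real) \<Rightarrow> bool" where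
  "uniformly_Lipschitz_bounded T X f \<longleftrightarrow>
     (\<exists>L. \<forall>t\<in>T. L-lipschitz_on X (f t)) \<and> (\<exists>C. \<forall>t\<in>T. \<forall>z\<in>X. \<bar>f t z\<bar> \<le> C)"

lemma uniformly_Lipschitz_boundedI:
  assumes "\<And>t x y. t \<in> T \<Longrightarrow> x \<in> X \<Longrightarrow> y \<in> X \<Longrightarrow> \<bar>f t x - f t y\<bar> \<le> L * dist x y"
    and "\<And>t x. t \<in> T \<Longrightarrow> x \<in> X \<Longrightarrow> \<bar>f t x\<bar> \<le> C"
  shows "uniformly_Lipschitz_bounded T X f"
  unfolding uniformly_Lipschitz_bounded_def
proof
  have "(max L 0)-lipschitz_on X (f t)" if "t \<in> T" for t
  proof (rule lipschitz_onI)
    fix x y assume "x \<in> X" "y \<in> X"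
    then have "\<bar>f t x - f t y\<bar> \<le> L * dist x y" using assms(1) that by blast
    also have "\<dots> \<le> max L 0 * dist x y" by (intro mult_right_mono) auto
    finally show "dist (f t x) (f t y) \<le> max L 0 * dist x y" by (simp add: dist_real_def)
  qed simp
  then show "\<exists>L. \<forall>t\<in>T. L-lipschitz_on X (f t)" by blast
qed (use assms(2) in blast)

lemma uniformly_Lipschitz_boundedE:
  assumes "uniformly_Lipschitz_bounded T X f"
  obtains L C where "L \<ge> 0" "C \<ge> 0"
    "\<And>t x y. t \<in> T \<Longrightarrow> x \<in> X \<Longrightarrow> y \<in> X \<Longrightarrow> \<bar>f t x - f t y\<bar> \<le> L * dist x y"
    "\<And>t x. t \<in> T \<Longrightarrow> x \<in> X \<Longrightarrow> \<bar>f t x\<bar> \<le> C"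
proof -
  obtain L C where LC: "\<forall>t\<in>T. L-lipschitz_on X (f t)" "\<forall>t\<in>T. \<forall>z\<in>X. \<bar>f t z\<bar> \<le> C"
    using assms unfolding uniformly_Lipschitz_bounded_def by blast
  show thesis
  proof
    fix t x y assume *: "t \<in> T" "x \<in> X" "y \<in> X"
    have "\<bar>f t x - f t y\<bar> \<le> L * dist x y"
      using lipschitz_onD LC(1) * by (metis dist_real_def)
    also have "\<dots> \<le> max L 0 * dist x y" by (intro mult_right_mono) auto
    finally show "\<bar>f t x - f t y\<bar> \<le> max L 0 * dist x y" .
  next
    show "\<bar>f t x\<bar> \<le> max C 0" if "t \<in> T" "x \<in> X" for t x
      using LC(2) that by (meson max.coboundedI1)
  qed auto
qed

lemma uniformly_Lipschitz_bounded_const: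
  "uniformly_Lipschitz_bounded T X (\<lambda>_ _. c)"
  by (rule uniformly_Lipschitz_boundedI[where L = 0 and C = "\<bar>c\<bar>"]) auto

lemma uniformly_Lipschitz_bounded_add:
  assumes "uniformly_Lipschitz_bounded T X f" "uniformly_Lipschitz_bounded T X g"
  shows "uniformly_Lipschitz_bounded T X (\<lambda>t z. f t z + g t z)"
proof -
  obtain L C where f: "\<And>t x y. t \<in> T \<Longrightarrow> x \<in> X \<Longrightarrow> y \<in> X \<Longrightarrow> \<bar>f t x - f t y\<bar> \<le> L * dist x y"
    "\<And>t x. t \<in> T \<Longrightarrow> x \<in> X \<Longrightarrow> \<bar>f t x\<bar> \<le> C"
    using assms(1) by (elim uniformly_Lipschitz_boundedE) blast
  obtain L' C' where g: "\<And>t x y. t \<in> T \<Longrightarrow> x \<in> X \<Longrightarrow> y \<in> X \<Longrightarrow> \<bar>g t x - g t y\<bar> \<le> L' * dist x y"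
    "\<And>t x. t \<in> T \<Longrightarrow> x \<in> X \<Longrightarrow> \<bar>g t x\<bar> \<le> C'"
    using assms(2) by (elim uniformly_Lipschitz_boundedE) blast
  show ?thesis
  proof (rule uniformly_Lipschitz_boundedI)
    show "\<bar>f t x + g t x - (f t y + g t y)\<bar> \<le> (L + L') * dist x y"
      if "t \<in> T" "x \<in> X" "y \<in> X" for t x y
      using f(1)[OF that] g(1)[OF that] by (simp add: distrib_right abs_le_iff)
    show "\<bar>f t x + g t x\<bar> \<le> C + C'" if "t \<in> T" "x \<in> X" for t x
      using f(2)[OF that] g(2)[OF that] by (simp add: abs_le_iff)
  qed
qed

lemma uniformly_Lipschitz_bounded_mult:
  assumes "uniformly_Lipschitz_bounded T X f" "uniformly_Lipschitz_bounded T X g"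
  shows "uniformly_Lipschitz_bounded T X (\<lambda>t z. f t z * g t z)"
proof -
  obtain L C where f: "\<And>t x y. t \<in> T \<Longrightarrow> x \<in> X \<Longrightarrow> y \<in> X \<Longrightarrow> \<bar>f t x - f t y\<bar> \<le> L * dist x y"
    "\<And>t x. t \<in> T \<Longrightarrow> x \<in> X \<Longrightarrow> \<bar>f t x\<bar> \<le> C" and LC: "L \<ge> 0" "C \<ge> 0"
    using assms(1) by (elim uniformly_Lipschitz_boundedE) blast
  obtain L' C' where g: "\<And>t x y. t \<in> T \<Longrightarrow> x \<in> X \<Longrightarrow> y \<in> X \<Longrightarrow> \<bar>g t x - g t y\<bar> \<le> L' * dist x y"
    "\<And>t x. t \<in> T \<Longrightarrow> x \<in> X \<Longrightarrow> \<bar>g t x\<bar> \<le> C'" and LC': "L' \<ge> 0" "C' \<ge> 0"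
    using assms(2) by (elim uniformly_Lipschitz_boundedE) blast
  show ?thesis
  proof (rule uniformly_Lipschitz_boundedI)
    fix t x y assume *: "t \<in> T" "x \<in> X" "y \<in> X"
    have "\<bar>f t x * g t x - f t y * g t y\<bar> = \<bar>f t x * (g t x - g t y) + (f t x - f t y) * g t y\<bar>"
      by (simp add: algebra_simps)
    also have "\<dots> \<le> \<bar>f t x\<bar> * \<bar>g t x - g t y\<bar> + \<bar>f t x - f t y\<bar> * \<bar>g t y\<bar>"
      by (rule order_trans[OF abs_triangle_ineq]) (simp add: abs_mult)
    also have "\<dots> \<le> C * (L' * dist x y) + (L * dist x y) * C'"
      using f g * LC LC' by (intro add_mono mult_mono) auto
    also have "\<dots> = (C * L' + L * C') * dist x y" by (simp add: algebra_simps)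
    finally show "\<bar>f t x * g t x - f t y * g t y\<bar> \<le> (C * L' + L * C') * dist x y" .
  next
    show "\<bar>f t x * g t x\<bar> \<le> C * C'" if "t \<in> T" "x \<in> X" for t x
      unfolding abs_mult using f(2) g(2) that LC by (intro mult_mono) auto
  qed
qed

lemma uniformly_Lipschitz_bounded_diff:
  assumes "uniformly_Lipschitz_bounded T X f" "uniformly_Lipschitz_bounded T X g"
  shows "uniformly_Lipschitz_bounded T X (\<lambda>t z. f t z - g t z)"
  using uniformly_Lipschitz_bounded_add[OF assms(1)
      uniformly_Lipschitz_bounded_mult[OF uniformly_Lipschitz_bounded_const[of _ _ "-1"] assms(2)]]
  by simp

lemma uniformly_Lipschitz_bounded_inverse:
  assumes "uniformly_Lipschitz_bounded T X f"
    and "\<delta> > 0" "\<And>t z. t \<in> T \<Longrightarrow> z \<in> X \<Longrightarrow> f t z \<ge> \<delta>"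
  shows "uniformly_Lipschitz_bounded T X (\<lambda>t z. inverse (f t z))"
proof -
  obtain L C where f: "\<And>t x y. t \<in> T \<Longrightarrow> x \<in> X \<Longrightarrow> y \<in> X \<Longrightarrow> \<bar>f t x - f t y\<bar> \<le> L * dist x y"
    using assms(1) by (elim uniformly_Lipschitz_boundedE) blast
  have inv: "inverse (f t x) > 0" "inverse (f t x) \<le> inverse \<delta>" if "t \<in> T" "x \<in> X" for t x
  proof -
    show "inverse (f t x) > 0" using assms(2) assms(3)[OF that] by simp
    show "inverse (f t x) \<le> inverse \<delta>" using assms(2) assms(3)[OF that] by (intro le_imp_inverse_le)
  qed
  show ?thesis
  proof (rule uniformly_Lipschitz_boundedI)
    fix t x y assume *: "t \<in> T" "x \<in> X" "y \<in> X"
    have pos: "f t x > 0" "f t y > 0" using assms(2) assms(3)[OF *(1,2)] assms(3)[OF *(1,3)] by auto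
    then have "\<bar>inverse (f t x) - inverse (f t y)\<bar> = \<bar>inverse (f t x) * inverse (f t y) * (f t y - f t x)\<bar>"
      by (simp add: field_simps)
    also have "\<dots> = inverse (f t x) * inverse (f t y) * \<bar>f t x - f t y\<bar>"
      using pos by (simp add: abs_mult abs_minus_commute)
    also have "\<dots> \<le> inverse \<delta> * inverse \<delta> * (L * dist x y)"
      using inv[OF *(1,2)] inv[OF *(1,3)] f[OF *] assms(2) by (intro mult_mono) auto
    finally show "\<bar>inverse (f t x) - inverse (f t y)\<bar> \<le> (inverse \<delta> * inverse \<delta> * L) * dist x y"
      by (simp add: mult.assoc)
  next
    show "\<bar>inverse (f t x)\<bar> \<le> inverse \<delta>" if "t \<in> T" "x \<in> X" for t x
      using inv[OF that] by linarith
  qed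
qed

lemma abs_sin_diff_le: "\<bar>sin x - sin y\<bar> \<le> \<bar>x - y\<bar>" for x y :: real
proof -
  have "\<bar>sin x - sin y\<bar> = 2 * (\<bar>sin ((x - y) / 2)\<bar> * \<bar>cos ((x + y) / 2)\<bar>)"
    by (simp add: sin_diff_sin abs_mult)
  also have "\<dots> \<le> 2 * (\<bar>(x - y) / 2\<bar> * 1)"
    by (intro mult_left_mono mult_mono abs_sin_x_le_abs_x) auto
  finally show ?thesis by simp
qed

lemma abs_cos_diff_le: "\<bar>cos x - cos y\<bar> \<le> \<bar>x - y\<bar>" for x y :: real
  using abs_sin_diff_le[of "pi / 2 - x" "pi / 2 - y"]
  by (simp add: cos_sin_eq abs_minus_commute)

lemma uniformly_Lipschitz_bounded_sin:
  assumes "uniformly_Lipschitz_bounded T X f"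
  shows "uniformly_Lipschitz_bounded T X (\<lambda>t z. sin (f t z))"
  using assms
  by (elim uniformly_Lipschitz_boundedE, intro uniformly_Lipschitz_boundedI[where C = 1])
     (auto intro: order_trans[OF abs_sin_diff_le])

lemma uniformly_Lipschitz_bounded_cos:
  assumes "uniformly_Lipschitz_bounded T X f"
  shows "uniformly_Lipschitz_bounded T X (\<lambda>t z. cos (f t z))"
  using assms
  by (elim uniformly_Lipschitz_boundedE, intro uniformly_Lipschitz_boundedI[where C = 1])
     (auto intro: order_trans[OF abs_cos_diff_le])

lemmas uniformly_Lipschitz_bounded_intros =
  uniformly_Lipschitz_bounded_const uniformly_Lipschitz_bounded_add
  uniformly_Lipschitz_bounded_diff uniformly_Lipschitz_bounded_mult
  uniformly_Lipschitz_bounded_sin uniformly_Lipschitz_bounded_cos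

text \<open>The cart position is absent because it enters the field only through the force, which
  has its own lemma.\<close>

lemma uniformly_Lipschitz_bounded_coordinates:
  fixes R :: real
  shows "uniformly_Lipschitz_bounded T (cball (0::state) R) (\<lambda>_ z. fst z)"
    and "uniformly_Lipschitz_bounded T (cball (0::state) R) (\<lambda>_ z. fst (snd z))"
    and "uniformly_Lipschitz_bounded T (cball (0::state) R) (\<lambda>_ z. snd (snd (snd z)))"
proof -
  have nrm: "\<bar>fst z\<bar> \<le> norm z" "\<bar>fst (snd z)\<bar> \<le> norm z" "\<bar>snd (snd (snd z))\<bar> \<le> norm z" for z :: state
    by (metis norm_fst_le norm_snd_le order_trans real_norm_def surjective_pairing)+
  have dst: "\<bar>fst x - fst y\<bar> \<le> 1 * dist x y" "\<bar>fst (snd x) - fst (snd y)\<bar> \<le> 1 * dist x y"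
    "\<bar>snd (snd (snd x)) - snd (snd (snd y))\<bar> \<le> 1 * dist x y" for x y :: state
    using nrm[of "x - y"] by (simp_all add: dist_norm)
  have bd: "\<bar>fst z\<bar> \<le> R" "\<bar>fst (snd z)\<bar> \<le> R" "\<bar>snd (snd (snd z))\<bar> \<le> R" if "z \<in> cball 0 R" for z :: state
    using nrm[of z] that by auto
  show "uniformly_Lipschitz_bounded T (cball (0::state) R) (\<lambda>_ z. fst z)"
    and "uniformly_Lipschitz_bounded T (cball (0::state) R) (\<lambda>_ z. fst (snd z))"
    and "uniformly_Lipschitz_bounded T (cball (0::state) R) (\<lambda>_ z. snd (snd (snd z)))"
    using dst bd by (blast intro: uniformly_Lipschitz_boundedI)+
qed

text \<open>The ball times the time interval becomes a compact set \<open>K\<close> of the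
  five-dimensional space after reordering coordinates. Each time slice of \<open>K\<close> with
  \<open>t\<close> in the interval contains the ball, so the constant for \<open>K\<close> works for
  all these times.\<close>

lemma uniformly_Lipschitz_bounded_force:
  assumes "u \<in> Lip"
  shows "uniformly_Lipschitz_bounded {a..b} (cball 0 R)
    (\<lambda>t z. u (fst z, fst (snd z), fst (snd (snd z)), snd (snd (snd z)), t))"
proof -
  define \<iota> where "\<iota> = (\<lambda>(z :: state, t :: real). (fst z, fst (snd z), fst (snd (snd z)), snd (snd (snd z)), t))"
  define K where "K = \<iota> ` (cball 0 R \<times> {a..b})"
  have "continuous_on (cball 0 R \<times> {a..b}) \<iota>"
    unfolding \<iota>_def case_prod_unfold by (intro continuous_intros)
  then have "compact K"
    unfolding K_def by (intro compact_continuous_image compact_Times) auto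
  then obtain L where L: "\<forall>t. L-lipschitz_on {(q, p, x, y). (q, p, x, y, t) \<in> K} (\<lambda>(q, p, x, y). u (q, p, x, y, t))"
    using assms unfolding Lip_def by blast
  have "continuous_on K u" using assms by (auto simp: Lip_def intro: continuous_on_subset)
  then have "bounded (u ` K)"
    using \<open>compact K\<close> by (intro compact_imp_bounded compact_continuous_image)
  then obtain C where C: "\<forall>k\<in>K. \<bar>u k\<bar> \<le> C" by (auto simp: bounded_iff)
  have K: "(fst z, fst (snd z), fst (snd (snd z)), snd (snd (snd z)), t) \<in> K"
    if "z \<in> cball 0 R" "t \<in> {a..b}" for z t
    unfolding K_def \<iota>_def using that by force
  show ?thesis
  proof (rule uniformly_Lipschitz_boundedI)
    fix t x y assume *: "t \<in> {a..b}" "x \<in> cball (0::state) R" "y \<in> cball (0::state) R"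
    show "\<bar>u (fst x, fst (snd x), fst (snd (snd x)), snd (snd (snd x)), t) -
        u (fst y, fst (snd y), fst (snd (snd y)), snd (snd (snd y)), t)\<bar> \<le> L * dist x y"
      using lipschitz_onD[OF L[rule_format, of t], of x y] K[OF *(2,1)] K[OF *(3,1)]
      by (simp add: case_prod_unfold dist_real_def)
  qed (use C K in blast)
qed

lemma locally_Lipschitz_ode_cart_pendulum:
  assumes "m > 0" "u \<in> Lip"
  shows "locally_Lipschitz_ode (cart_pendulum m u)"
proof
  have pos: "m + (cos q)\<^sup>2 \<noteq> 0" for q using assms(1) by (smt (verit) zero_le_power2)
  have u: "continuous_on UNIV u" using assms(2) by (simp add: Lip_def)
  show "continuous_on UNIV (\<lambda>(t, z). cart_pendulum m u t z)"
    unfolding cart_pendulum_def case_prod_unfold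
    by (intro continuous_intros continuous_on_compose2[OF u]) (simp_all add: pos)
  fix a b R :: real
  note intros = uniformly_Lipschitz_bounded_intros uniformly_Lipschitz_bounded_coordinates
    uniformly_Lipschitz_bounded_force[OF assms(2)]
  \<comment> \<open>The denominator is bounded below by \<open>m\<close>, the cosine term being a
    square.\<close>
  have inv: "uniformly_Lipschitz_bounded {a..b} (cball (0::state) R)
    (\<lambda>t z. inverse (m + cos (fst z) * cos (fst z)))"
    by (rule uniformly_Lipschitz_bounded_inverse[OF _ assms(1)]) (auto intro!: intros)
  define f1 where "f1 t z = fst (cart_pendulum m u t z)" for t z
  define f2 where "f2 t z = fst (snd (cart_pendulum m u t z))" for t z
  define f3 where "f3 t z = fst (snd (snd (cart_pendulum m u t z)))" for t z
  define f4 where "f4 t z = snd (snd (snd (cart_pendulum m u t z)))" for t z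
  note f_defs = f1_def f2_def f3_def f4_def
  have "uniformly_Lipschitz_bounded {a..b} (cball 0 R) f1" "uniformly_Lipschitz_bounded {a..b} (cball 0 R) f2"
    "uniformly_Lipschitz_bounded {a..b} (cball 0 R) f3" "uniformly_Lipschitz_bounded {a..b} (cball 0 R) f4"
    unfolding f_defs[abs_def] cart_pendulum_def case_prod_unfold fst_conv snd_conv
      divide_inverse power2_eq_square
    by (intro intros inv)+
  then obtain L1 L2 L3 L4 where L: "\<forall>t\<in>{a..b}. L1-lipschitz_on (cball 0 R) (f1 t)"
    "\<forall>t\<in>{a..b}. L2-lipschitz_on (cball 0 R) (f2 t)"
    "\<forall>t\<in>{a..b}. L3-lipschitz_on (cball 0 R) (f3 t)"
    "\<forall>t\<in>{a..b}. L4-lipschitz_on (cball 0 R) (f4 t)"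
    unfolding uniformly_Lipschitz_bounded_def by blast
  have eq: "cart_pendulum m u t = (\<lambda>z. (f1 t z, f2 t z, f3 t z, f4 t z))" for t
    by (simp add: f_defs)
  \<comment> \<open>The norm on nested pairs is Euclidean, so the constants of the components
    combine by nested square roots.\<close>
  have "\<forall>t\<in>{a..b}. (sqrt (L1\<^sup>2 + (sqrt (L2\<^sup>2 + (sqrt (L3\<^sup>2 + L4\<^sup>2))\<^sup>2))\<^sup>2))-lipschitz_on (cball 0 R)
      (\<lambda>z. (f1 t z, f2 t z, f3 t z, f4 t z))"
    by (intro ballI lipschitz_on_Pair) (use L in auto)
  then show "\<exists>L. \<forall>t\<in>{a..b}. L-lipschitz_on (cball 0 R) (cart_pendulum m u t)"
    unfolding eq by blast
qed

section \<open>Exit from open sets\<close>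

text \<open>The times spent outside an open set form a compact set, whose minimum is the exit time.
  It may equal \<open>a\<close>, which callers exclude by the starting point.\<close>

lemma first_exit:
  fixes \<phi> :: "real \<Rightarrow> 'a::topological_space"
  assumes "continuous_on {a..b} \<phi>" "open A" "a \<le> b" "\<phi> b \<notin> A"
  obtains \<tau> where "\<tau> \<in> {a..b}" "\<phi> \<tau> \<notin> A" "\<And>t. t \<in> {a..<\<tau>} \<Longrightarrow> \<phi> t \<in> A"
proof -
  define S where "S = {a..b} \<inter> \<phi> -` (- A)"
  have "closed S"
    unfolding S_def using assms by (intro continuous_closed_preimage) auto
  moreover have "S \<subseteq> {a..b}" by (auto simp: S_def)
  ultimately have "compact S" by (meson bounded_closed_interval bounded_subset compact_eq_bounded_closed)
  moreover have "b \<in> S" using assms by (auto simp: S_def)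
  ultimately obtain \<tau> where \<tau>: "\<tau> \<in> S" "\<And>t. t \<in> S \<Longrightarrow> \<tau> \<le> t"
    using compact_attains_inf[of S] by blast
  have "\<phi> t \<in> A" if "t \<in> {a..<\<tau>}" for t
    using \<tau>(1) \<tau>(2)[of t] that by (auto simp: S_def)
  with \<tau>(1) show thesis by (intro that[of \<tau>]) (auto simp: S_def)
qed

lemma ge_at_right_endpoint:
  fixes f :: "real \<Rightarrow> real"
  assumes "continuous_on {a..b} f" "a < b" "\<And>t. t \<in> {a..<b} \<Longrightarrow> c \<le> f t"
  shows "c \<le> f b"
  using continuous_ge_on_closure[of "{a..<b}" f b c] assms by auto

text \<open>The sphere is a barrier. Up to the first exit from the sublevel set the orbit stays in
  the closed ball and \<open>V\<close> does not increase, so \<open>V\<close> is still below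
  \<open>c\<close> at the exit time; hence the orbit is not on the sphere and has not left after
  all.\<close>

lemma sublevel_ball_forward_invariant:
  fixes F :: "real \<Rightarrow> 'a::real_inner \<Rightarrow> 'a"
  assumes \<phi>: "solution_on F J \<phi>" "{s..t} \<subseteq> J" "s \<le> t"
    and deriv: "\<And>z. z \<in> cball \<mu> r \<Longrightarrow> (V has_derivative (\<lambda>h. G z \<bullet> h)) (at z)"
    and decr: "\<And>z t. z \<in> cball \<mu> r \<Longrightarrow> derivative_along F G t z \<le> 0"
    and sphere: "\<And>z. z \<in> sphere \<mu> r \<Longrightarrow> c \<le> V z"
    and start: "\<phi> s \<in> {z \<in> ball \<mu> r. V z < c}"
  shows "\<phi> t \<in> {z \<in> ball \<mu> r. V z < c}"
proof (rule ccontr)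
  define B where "B = {z \<in> ball \<mu> r. V z < c}"
  assume "\<phi> t \<notin> {z \<in> ball \<mu> r. V z < c}"
  then have out: "\<phi> t \<notin> B" by (simp add: B_def)
  have cont: "continuous_on {s..t} \<phi>"
    using continuous_on_subset[OF solution_on_continuous[OF \<phi>(1)] \<phi>(2)] .
  have "continuous_on (ball \<mu> r) V"
    using deriv by (intro has_derivative_continuous_on[of _ _ "\<lambda>z h. G z \<bullet> h"])
      (auto intro: has_derivative_at_withinI)
  then have "open B"
    using continuous_open_preimage[of "ball \<mu> r" V "{..<c}"]
    by (auto simp: B_def vimage_def Int_def)
  then obtain \<tau> where \<tau>: "\<tau> \<in> {s..t}" "\<phi> \<tau> \<notin> B" "\<And>t. t \<in> {s..<\<tau>} \<Longrightarrow> \<phi> t \<in> B"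
    using first_exit[OF cont _ \<phi>(3) out] by blast
  have "\<phi> s \<in> B" using start by (simp add: B_def)
  then have "s < \<tau>" using \<tau>(1,2) by (cases "s = \<tau>") auto
  have cont\<tau>: "continuous_on {s..\<tau>} \<phi>" using cont \<tau>(1) by (auto intro: continuous_on_subset)
  \<comment> \<open>At the exit time continuity yields only the closed ball, which is why the
    derivative of \<open>V\<close> is assumed on the sphere too.\<close>
  have "0 \<le> r - dist \<mu> (\<phi> \<tau>)"
    by (rule ge_at_right_endpoint[OF _ \<open>s < \<tau>\<close>])
       (use \<tau>(3) cont\<tau> in \<open>auto intro!: continuous_intros simp: B_def less_imp_le\<close>)
  then have cball: "\<phi> \<sigma> \<in> cball \<mu> r" if "\<sigma> \<in> {s..\<tau>}" for \<sigma>
    using \<tau>(3)[of \<sigma>] that by (cases "\<sigma> = \<tau>") (auto simp: B_def)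
  have "V (\<phi> \<tau>) \<le> V (\<phi> s)"
  proof (rule DERIV_nonpos_imp_nonincreasing[where f = "\<lambda>t. V (\<phi> t)"])
    show "s \<le> \<tau>" using \<open>s < \<tau>\<close> by simp
    fix \<sigma> assume \<sigma>: "s \<le> \<sigma>" "\<sigma> \<le> \<tau>"
    then have "\<sigma> \<in> J" using \<phi>(2) \<tau>(1) by auto
    then have "(\<phi> has_derivative (\<lambda>h. h *\<^sub>R F \<sigma> (\<phi> \<sigma>))) (at \<sigma>)"
      using \<phi>(1) by (simp add: solution_on_def has_vector_derivative_def)
    from has_derivative_compose[OF this deriv] \<sigma> cball[of \<sigma>]
    have "((\<lambda>t. V (\<phi> t)) has_derivative (\<lambda>h. G (\<phi> \<sigma>) \<bullet> (h *\<^sub>R F \<sigma> (\<phi> \<sigma>)))) (at \<sigma>)" by simp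
    then have "((\<lambda>t. V (\<phi> t)) has_real_derivative derivative_along F G \<sigma> (\<phi> \<sigma>)) (at \<sigma>)"
      by (simp add: has_field_derivative_def derivative_along_def mult.commute[of _ "_ \<bullet> _"])
    then show "\<exists>y. ((\<lambda>t. V (\<phi> t)) has_real_derivative y) (at \<sigma>) \<and> y \<le> 0"
      using decr cball[of \<sigma>] \<sigma> by auto
  qed
  then have "V (\<phi> \<tau>) < c" using start by simp
  moreover have "\<phi> \<tau> \<notin> sphere \<mu> r" using sphere calculation by force
  moreover have "\<phi> \<tau> \<in> cball \<mu> r" using cball \<open>s < \<tau>\<close> by simp
  ultimately have "\<phi> \<tau> \<in> B" by (auto simp: B_def)
  with \<tau>(2) show False by simp
qed

text \<open>If \<open>f\<close> and \<open>g\<close> both vanish at \<open>\<tau>\<close>, then \<open>g' < 0\<close> makes \<open>f\<close> increase just before \<open>\<tau>\<close>.\<close>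
lemma transversal_arrival:
  fixes f g :: "real \<Rightarrow> real"
  assumes "a < \<tau>"
    and pos: "\<And>t. t \<in> {a..<\<tau>} \<Longrightarrow> f t > 0" and zero: "f \<tau> = 0"
    and f: "\<And>t. t \<in> {a..\<tau>} \<Longrightarrow> (f has_real_derivative g t) (at t)"
    and g: "g \<tau> = 0 \<Longrightarrow> (g has_real_derivative g') (at \<tau>)" "g' < 0"
  shows "g \<tau> < 0"
proof (rule ccontr)
  assume "\<not> g \<tau> < 0"
  have f\<tau>: "(f has_real_derivative g \<tau>) (at \<tau>)" using f \<open>a < \<tau>\<close> by simp
  \<comment> \<open>If \<open>g \<tau> > 0\<close>, \<open>f\<close> is smaller just before
    \<open>\<tau>\<close>. If \<open>g \<tau> = 0\<close>, then \<open>g' < 0\<close> makes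
    \<open>g\<close> positive just before \<open>\<tau>\<close>, so \<open>f\<close> is
    nondecreasing there. Either way \<open>f\<close> cannot have come down to 0 from positive
    values.\<close>
  have "\<exists>d>0. \<forall>h>0. h < d \<longrightarrow> f (\<tau> - h) \<le> f \<tau>"
  proof (cases "g \<tau> > 0")
    case True
    then show ?thesis using DERIV_pos_inc_left[OF f\<tau>] by (meson less_imp_le)
  next
    case False
    then have g0: "g \<tau> = 0" using \<open>\<not> g \<tau> < 0\<close> by simp
    then obtain d where d: "d > 0" "\<And>h. 0 < h \<Longrightarrow> h < d \<Longrightarrow> g \<tau> < g (\<tau> - h)"
      using DERIV_neg_dec_left[OF g(1) g(2)] by blast
    have "f (\<tau> - h) \<le> f \<tau>" if h: "0 < h" "h < min d (\<tau> - a)" for h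
    proof (rule DERIV_nonneg_imp_nondecreasing[where f = f])
      fix t assume t: "\<tau> - h \<le> t" "t \<le> \<tau>"
      have "g t \<ge> 0" using d(2)[of "\<tau> - t"] g0 t h by (cases "t = \<tau>") auto
      then show "\<exists>y. (f has_real_derivative y) (at t) \<and> 0 \<le> y"
        using f[of t] t h by auto
    qed (use h in auto)
    moreover have "min d (\<tau> - a) > 0" using d(1) \<open>a < \<tau>\<close> by simp
    ultimately show ?thesis by blast
  qed
  then obtain d where d: "d > 0" "\<And>h. 0 < h \<Longrightarrow> h < d \<Longrightarrow> f (\<tau> - h) \<le> 0" using zero by auto
  define h where "h = min (d / 2) (\<tau> - a)"
  have "0 < h" "h < d" "h \<le> \<tau> - a" using d(1) \<open>a < \<tau>\<close> by (auto simp: h_def)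
  then show False using d(2)[of h] pos[of "\<tau> - h"] by auto
qed

lemma transversal_exit:
  fixes f :: "real \<Rightarrow> real"
  assumes f: "(f has_real_derivative g) (at \<tau>)" "g < 0" and zero: "f \<tau> = 0"
    and J: "open J" "\<tau> \<in> J"
  obtains T where "T > \<tau>" "{\<tau>..T} \<subseteq> J" "\<And>t. t \<in> {\<tau><..T} \<Longrightarrow> f t < 0"
proof -
  obtain d where d: "d > 0" "\<And>h. 0 < h \<Longrightarrow> h < d \<Longrightarrow> f (\<tau> + h) < f \<tau>"
    using DERIV_neg_dec_right[OF f] by blast
  obtain e where e: "e > 0" "cball \<tau> e \<subseteq> J" using J by (meson open_contains_cball)
  define T where "T = \<tau> + min (d / 2) e"
  show thesis
  proof
    show "T > \<tau>" using d(1) e(1) by (simp add: T_def)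
    show "{\<tau>..T} \<subseteq> J" using e by (force simp: T_def dist_real_def)
    show "f t < 0" if "t \<in> {\<tau><..T}" for t
      using d(2)[of "t - \<tau>"] d(1) that zero by (auto simp: T_def)
  qed
qed

section \<open>The inverted pendulum\<close>

lemma open_above_horizontal: "open above_horizontal"
proof -
  have eq: "above_horizontal = {z. 0 < fst z} \<inter> {z. fst z < pi}"
    by (auto simp: above_horizontal_def)
  show ?thesis
    unfolding eq by (intro open_Int open_Collect_less continuous_intros)
qed

lemma mem_above_horizontal: "z \<in> above_horizontal \<longleftrightarrow> 0 < fst z \<and> fst z < pi"
  by (cases z) (simp add: above_horizontal_def)

lemma cart_pendulum_solution_derivatives:
  assumes "solution_on (cart_pendulum m u) J \<phi>" "t \<in> J"
  shows "((\<lambda>t. fst (\<phi> t)) has_real_derivative fst (snd (\<phi> t))) (at t)"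
    and "((\<lambda>t. fst (snd (\<phi> t))) has_real_derivative fst (snd (cart_pendulum m u t (\<phi> t)))) (at t)"
proof -
  have \<phi>: "(\<phi> has_vector_derivative cart_pendulum m u t (\<phi> t)) (at t)"
    using assms by (simp add: solution_on_def)
  have "fst (cart_pendulum m u t z) = fst (snd z)" for z
    by (simp add: cart_pendulum_def case_prod_unfold)
  then show "((\<lambda>t. fst (\<phi> t)) has_real_derivative fst (snd (\<phi> t))) (at t)"
    using bounded_linear.has_vector_derivative[OF bounded_linear_fst \<phi>]
    by (simp add: has_real_derivative_iff_has_vector_derivative)
  show "((\<lambda>t. fst (snd (\<phi> t))) has_real_derivative fst (snd (cart_pendulum m u t (\<phi> t)))) (at t)"
    using bounded_linear.has_vector_derivative[OF bounded_linear_fst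
        bounded_linear.has_vector_derivative[OF bounded_linear_snd \<phi>]]
    by (simp add: has_real_derivative_iff_has_vector_derivative)
qed

text \<open>The factor \<open>sin q\<close> removes both the force and the velocity term, leaving
  \<open>- (1 + m) * cos q / (m + 1)\<close> with \<open>cos q\<close> equal to 1 or -1.\<close>

lemma cart_pendulum_horizontal:
  assumes "m > 0"
  shows "fst z = 0 \<Longrightarrow> fst (snd (cart_pendulum m u t z)) = -1"
    and "fst z = pi \<Longrightarrow> fst (snd (cart_pendulum m u t z)) = 1"
  using assms by (auto simp: cart_pendulum_def case_prod_unfold field_simps)

context locally_Lipschitz_ode begin

text \<open>At the earlier of the two arrival times the trajectory is in one target while still
  confined to the other's region.\<close>

lemma reaching_within_disjoint:
  assumes "z \<in> reaching_within t\<^sub>0 W A" "z \<in> reaching_within t\<^sub>0 W' A'"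
    and "A \<inter> W' = {}" "A' \<inter> W = {}"
  shows False
proof -
  obtain J \<phi> where max: "maximal_solution F t\<^sub>0 z J \<phi>" by (rule maximal_solution_exists)
  obtain T where T: "t\<^sub>0 \<le> T" "\<phi> ` {t\<^sub>0..T} \<subseteq> W" "\<phi> T \<in> A"
    using assms(1) unfolding reaching_within_iff[OF max] by blast
  obtain T' where T': "t\<^sub>0 \<le> T'" "\<phi> ` {t\<^sub>0..T'} \<subseteq> W'" "\<phi> T' \<in> A'"
    using assms(2) unfolding reaching_within_iff[OF max] by blast
  show False
  proof (cases "T \<le> T'")
    case True
    then have "\<phi> T \<in> W'" using T T' by auto
    with T assms(3) show False by blast
  next
    case False
    then have "\<phi> T' \<in> W" using T T' by auto
    with T' assms(4) show False by blast
  qed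
qed

end

section \<open>Falling over and staying in the strip\<close>

locale cart_pendulum_system =
  fixes m :: real and u :: "real \<times> real \<times> real \<times> real \<times> real \<Rightarrow> real" and t\<^sub>0 :: real
  assumes mass_pos: "m > 0" and force_Lip: "u \<in> Lip"

sublocale cart_pendulum_system \<subseteq> locally_Lipschitz_ode "cart_pendulum m u"
  by (rule locally_Lipschitz_ode_cart_pendulum[OF mass_pos force_Lip])

context cart_pendulum_system begin

text \<open>The path is constrained only on the far side, so it may pass through q = 0 and may even
  start there. Both conditions are strict, as openness requires, and a left fall cannot be preceded
  by a right one.\<close>

definition falls_left :: "state set" where
  "falls_left = reaching_within t\<^sub>0 {z. fst z < pi} {z. fst z < 0}"

definition falls_right :: "state set" where
  "falls_right = reaching_within t\<^sub>0 {z. 0 < fst z} {z. pi < fst z}"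

text \<open>The case \<open>\<tau> = t\<^sub>0\<close> is included: \<open>before\<close> is then
  vacuous, and a state on q = 0 moving outward falls at once.\<close>

lemma falls_leftI:
  assumes max: "maximal_solution (cart_pendulum m u) t\<^sub>0 z J \<phi>"
    and \<tau>: "\<tau> \<in> J" "t\<^sub>0 \<le> \<tau>" "fst (\<phi> \<tau>) = 0" "fst (snd (\<phi> \<tau>)) < 0"
    and before: "\<And>t. t \<in> {t\<^sub>0..<\<tau>} \<Longrightarrow> fst (\<phi> t) < pi"
  shows "z \<in> falls_left"
proof -
  have sol: "solution_on (cart_pendulum m u) J \<phi>" using max by (simp add: maximal_solution_def)
  obtain T where T: "T > \<tau>" "{\<tau>..T} \<subseteq> J" "\<And>t. t \<in> {\<tau><..T} \<Longrightarrow> fst (\<phi> t) < 0"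
    using transversal_exit[OF cart_pendulum_solution_derivatives(1)[OF sol \<tau>(1)] \<tau>(4,3) _ \<tau>(1)] sol
    by (auto simp: solution_on_def)
  have "fst (\<phi> t) < pi" if "t \<in> {t\<^sub>0..T}" for t
  proof (cases "t < \<tau>")
    case False
    then have "t = \<tau> \<or> t \<in> {\<tau><..T}" using that by auto
    then show ?thesis using T(3)[of t] \<tau>(3) pi_gt_zero by (smt (verit))
  qed (use before that in auto)
  then show ?thesis
    unfolding falls_left_def reaching_within_iff[OF max]
    using T \<tau>(2) by (intro bexI[of _ T]) auto
qed

lemma falls_rightI:
  assumes max: "maximal_solution (cart_pendulum m u) t\<^sub>0 z J \<phi>"
    and \<tau>: "\<tau> \<in> J" "t\<^sub>0 \<le> \<tau>" "fst (\<phi> \<tau>) = pi" "fst (snd (\<phi> \<tau>)) > 0"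
    and before: "\<And>t. t \<in> {t\<^sub>0..<\<tau>} \<Longrightarrow> 0 < fst (\<phi> t)"
  shows "z \<in> falls_right"
proof -
  have sol: "solution_on (cart_pendulum m u) J \<phi>" using max by (simp add: maximal_solution_def)
  have "((\<lambda>t. pi - fst (\<phi> t)) has_real_derivative - fst (snd (\<phi> \<tau>))) (at \<tau>)"
    using cart_pendulum_solution_derivatives(1)[OF sol \<tau>(1)] by (auto intro!: derivative_eq_intros)
  then obtain T where T: "T > \<tau>" "{\<tau>..T} \<subseteq> J" "\<And>t. t \<in> {\<tau><..T} \<Longrightarrow> pi - fst (\<phi> t) < 0"
    using transversal_exit[of "\<lambda>t. pi - fst (\<phi> t)" "- fst (snd (\<phi> \<tau>))" \<tau> J] \<tau> sol
    by (auto simp: solution_on_def)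
  have "0 < fst (\<phi> t)" if "t \<in> {t\<^sub>0..T}" for t
  proof (cases "t < \<tau>")
    case False
    then have "t = \<tau> \<or> t \<in> {\<tau><..T}" using that by auto
    then show ?thesis using T(3)[of t] \<tau>(3) pi_gt_zero by (smt (verit))
  qed (use before that in auto)
  then show ?thesis
    unfolding falls_right_def reaching_within_iff[OF max]
    using T \<tau>(2) by (intro bexI[of _ T]) auto
qed

text \<open>A first exit would occur at q = 0 or q = pi, with the velocity pointing strictly outward
  by \<open>transversal_arrival\<close>. The trajectory would then go on to cross the boundary,
  which is one of the two excluded falls.\<close>

lemma stays_above_horizontal:
  assumes max: "maximal_solution (cart_pendulum m u) t\<^sub>0 z J \<phi>"
    and z: "z \<in> above_horizontal" "z \<notin> falls_left" "z \<notin> falls_right"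
    and T: "T \<in> J" "t\<^sub>0 \<le> T"
  shows "\<phi> T \<in> above_horizontal"
proof (rule ccontr)
  assume out: "\<phi> T \<notin> above_horizontal"
  have sol: "solution_on (cart_pendulum m u) J \<phi>" and init: "t\<^sub>0 \<in> J" "\<phi> t\<^sub>0 = z"
    using max by (auto simp: maximal_solution_def)
  have sub: "{t\<^sub>0..T} \<subseteq> J"
    using sol init T by (intro is_interval_atLeastAtMost_subset) (auto simp: solution_on_def)
  have cont: "continuous_on {t\<^sub>0..T} \<phi>"
    using continuous_on_subset[OF solution_on_continuous[OF sol] sub] .
  obtain \<tau> where \<tau>: "\<tau> \<in> {t\<^sub>0..T}" "\<phi> \<tau> \<notin> above_horizontal"
    "\<And>t. t \<in> {t\<^sub>0..<\<tau>} \<Longrightarrow> \<phi> t \<in> above_horizontal"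
    using first_exit[OF cont open_above_horizontal T(2) out] by blast
  have "t\<^sub>0 < \<tau>" using \<tau>(1,2) z(1) init by (cases "t\<^sub>0 = \<tau>") auto
  have \<tau>J: "\<tau> \<in> J" "{t\<^sub>0..\<tau>} \<subseteq> J" using \<tau>(1) sub by auto
  have q: "0 < fst (\<phi> t)" "fst (\<phi> t) < pi" if "t \<in> {t\<^sub>0..<\<tau>}" for t
    using \<tau>(3)[OF that] by (auto simp: mem_above_horizontal)
  have contq: "continuous_on {t\<^sub>0..\<tau>} (\<lambda>t. fst (\<phi> t))"
    using continuous_on_subset[OF cont, of "{t\<^sub>0..\<tau>}"] \<tau>(1) by (auto intro!: continuous_intros)
  have "0 \<le> fst (\<phi> \<tau>)"
    using ge_at_right_endpoint[OF contq \<open>t\<^sub>0 < \<tau>\<close>] q by (simp add: less_imp_le)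
  moreover have "0 \<le> pi - fst (\<phi> \<tau>)"
    by (rule ge_at_right_endpoint[OF _ \<open>t\<^sub>0 < \<tau>\<close>]) (use q contq in \<open>auto intro!: continuous_intros simp: less_imp_le\<close>)
  ultimately consider "fst (\<phi> \<tau>) = 0" | "fst (\<phi> \<tau>) = pi"
    using \<tau>(2) unfolding mem_above_horizontal by linarith
  then show False
  proof cases
    case 1
    have "fst (snd (\<phi> \<tau>)) < 0"
    proof (rule transversal_arrival[OF \<open>t\<^sub>0 < \<tau>\<close>])
      show "((\<lambda>t. fst (\<phi> t)) has_real_derivative fst (snd (\<phi> t))) (at t)" if "t \<in> {t\<^sub>0..\<tau>}" for t
        using cart_pendulum_solution_derivatives(1)[OF sol] \<tau>J that by blast
      show "((\<lambda>t. fst (snd (\<phi> t))) has_real_derivative -1) (at \<tau>)"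
        using cart_pendulum_solution_derivatives(2)[OF sol \<tau>J(1)]
        by (simp add: cart_pendulum_horizontal(1)[OF mass_pos 1])
    qed (use q 1 in auto)
    then have "z \<in> falls_left" using q \<open>t\<^sub>0 < \<tau>\<close> by (intro falls_leftI[OF max \<tau>J(1) _ 1]) auto
    with z(2) show False ..
  next
    case 2
    have "- fst (snd (\<phi> \<tau>)) < 0"
    \<comment> \<open>The reflection of q to \<open>pi - q\<close> turns the acceleration 1 at q =
      pi into -1.\<close>
    proof (rule transversal_arrival[OF \<open>t\<^sub>0 < \<tau>\<close>, where f = "\<lambda>t. pi - fst (\<phi> t)"])
      show "((\<lambda>t. pi - fst (\<phi> t)) has_real_derivative - fst (snd (\<phi> t))) (at t)" if "t \<in> {t\<^sub>0..\<tau>}" for t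
        using cart_pendulum_solution_derivatives(1)[OF sol, of t] \<tau>J that
        by (auto intro!: derivative_eq_intros)
      show "((\<lambda>t. - fst (snd (\<phi> t))) has_real_derivative -1) (at \<tau>)"
        using DERIV_minus[OF cart_pendulum_solution_derivatives(2)[OF sol \<tau>J(1)]]
        by (simp add: cart_pendulum_horizontal(2)[OF mass_pos 2])
    qed (use q 2 in auto)
    then have "z \<in> falls_right" using q \<open>t\<^sub>0 < \<tau>\<close> by (intro falls_rightI[OF max \<tau>J(1) _ 2]) auto
    with z(3) show False ..
  qed
qed

section \<open>The connectedness argument\<close>

lemma exists_trajectory_avoiding:
  assumes B: "open B" "B \<subseteq> above_horizontal"
    and invariant: "\<And>J \<phi> s t. solution_on (cart_pendulum m u) J \<phi> \<Longrightarrow> {s..t} \<subseteq> J \<Longrightarrow> s \<le> t \<Longrightarrow> \<phi> s \<in> B \<Longrightarrow> \<phi> t \<in> B"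
  obtains z where "\<And>J \<phi> t. maximal_solution (cart_pendulum m u) t\<^sub>0 z J \<phi> \<Longrightarrow> t \<in> J \<Longrightarrow> t\<^sub>0 \<le> t \<Longrightarrow>
    \<phi> t \<in> above_horizontal - B"
proof -
  define caught where "caught = reaching_within t\<^sub>0 above_horizontal B"
  have open_sets: "open falls_left" "open falls_right" "open caught"
    unfolding falls_left_def falls_right_def caught_def
    by (intro open_reaching_within open_above_horizontal B open_Collect_less continuous_intros)+
  \<comment> \<open>Up to the capture time \<open>T'\<close> the trajectory is in the strip by
    definition of \<open>caught\<close>; afterwards invariance keeps it in \<open>B\<close>, hence
    again in the strip. It never meets a target outside.\<close>
  have not_caught: "z \<notin> caught"
    if reach: "z \<in> reaching_within t\<^sub>0 W A" and A: "A \<inter> above_horizontal = {}" for z W A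
  proof
    assume "z \<in> caught"
    obtain J \<phi> where max: "maximal_solution (cart_pendulum m u) t\<^sub>0 z J \<phi>" by (rule maximal_solution_exists)
    then have sol: "solution_on (cart_pendulum m u) J \<phi>" by (simp add: maximal_solution_def)
    obtain T where T: "T \<in> J" "t\<^sub>0 \<le> T" "\<phi> T \<in> A"
      using reach unfolding reaching_within_iff[OF max] by blast
    obtain T' where T': "T' \<in> J" "t\<^sub>0 \<le> T'" "\<phi> ` {t\<^sub>0..T'} \<subseteq> above_horizontal" "\<phi> T' \<in> B"
      using \<open>z \<in> caught\<close> unfolding caught_def reaching_within_iff[OF max] by blast
    have "\<phi> T \<in> above_horizontal"
    proof (cases "T \<le> T'")
      case True
      then show ?thesis using T T' by auto
    next
      case False
      then have "{T'..T} \<subseteq> J" using T T' sol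
        by (intro is_interval_atLeastAtMost_subset) (auto simp: solution_on_def)
      with invariant[OF sol this _ T'(4)] False B(2) show ?thesis by auto
    qed
    with T(3) A show False by blast
  qed
  have disj_lr: "z \<notin> falls_right" if "z \<in> falls_left" for z
  proof
    assume "z \<in> falls_right"
    with that show False unfolding falls_left_def falls_right_def
      by (rule reaching_within_disjoint) auto
  qed
  have disj_lc: "z \<notin> caught" if "z \<in> falls_left" for z
    by (rule not_caught[OF that[unfolded falls_left_def]]) (auto simp: mem_above_horizontal)
  have disj_rc: "z \<notin> caught" if "z \<in> falls_right" for z
    by (rule not_caught[OF that[unfolded falls_right_def]]) (auto simp: mem_above_horizontal)
  \<comment> \<open>The angular velocity runs from -1 at q = 0 to 1 at q = pi, so both endpoints
    move outward at time \<open>t\<^sub>0\<close>. The cart coordinates are set to 0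
    arbitrarily.\<close>
  define \<gamma> :: "real \<Rightarrow> state" where "\<gamma> q = (q, 2 * q / pi - 1, 0, 0)" for q
  have "continuous_on {0..pi} \<gamma>" unfolding \<gamma>_def by (intro continuous_intros) auto
  then have conn: "connected (\<gamma> ` {0..pi})" by (intro connected_continuous_image) auto
  have left: "\<gamma> 0 \<in> falls_left"
  proof -
    obtain J \<phi> where max: "maximal_solution (cart_pendulum m u) t\<^sub>0 (\<gamma> 0) J \<phi>" by (rule maximal_solution_exists)
    then show ?thesis by (intro falls_leftI[OF max, of t\<^sub>0]) (auto simp: maximal_solution_def \<gamma>_def)
  qed
  have right: "\<gamma> pi \<in> falls_right"
  proof -
    obtain J \<phi> where max: "maximal_solution (cart_pendulum m u) t\<^sub>0 (\<gamma> pi) J \<phi>" by (rule maximal_solution_exists)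
    then show ?thesis by (intro falls_rightI[OF max, of t\<^sub>0]) (auto simp: maximal_solution_def \<gamma>_def)
  qed
  \<comment> \<open>Grouping \<open>caught\<close> with \<open>falls_right\<close> reduces three
    disjoint open sets to the two of a separation, each of which meets the segment.\<close>
  have "\<not> \<gamma> ` {0..pi} \<subseteq> falls_left \<union> (falls_right \<union> caught)"
  proof
    assume "\<gamma> ` {0..pi} \<subseteq> falls_left \<union> (falls_right \<union> caught)"
    moreover have "falls_left \<inter> (falls_right \<union> caught) \<inter> \<gamma> ` {0..pi} = {}"
      using disj_lr disj_lc by blast
    moreover have "\<gamma> 0 \<in> falls_left \<inter> \<gamma> ` {0..pi}" using left by auto
    moreover have "\<gamma> pi \<in> (falls_right \<union> caught) \<inter> \<gamma> ` {0..pi}" using right by auto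
    ultimately show False
      using connectedD[OF conn open_sets(1) open_Un[OF open_sets(2,3)]] by blast
  qed
  then obtain q where q: "q \<in> {0..pi}" "\<gamma> q \<notin> falls_left" "\<gamma> q \<notin> falls_right" "\<gamma> q \<notin> caught" by blast
  then have "q \<noteq> 0" "q \<noteq> pi" using left right by auto
  then have above: "\<gamma> q \<in> above_horizontal" using q(1) by (auto simp: mem_above_horizontal \<gamma>_def)
  show thesis
  proof
    fix J \<phi> t assume max: "maximal_solution (cart_pendulum m u) t\<^sub>0 (\<gamma> q) J \<phi>" and t: "t \<in> J" "t\<^sub>0 \<le> t"
    have J: "{t\<^sub>0..t} \<subseteq> J" using max t
      by (intro is_interval_atLeastAtMost_subset) (auto simp: maximal_solution_def solution_on_def)
    have stays: "\<phi> s \<in> above_horizontal" if "s \<in> {t\<^sub>0..t}" for s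
      using stays_above_horizontal[OF max above q(2,3), of s] J that by auto
    moreover have "\<phi> t \<notin> B"
      using q(4) t stays unfolding caught_def reaching_within_iff[OF max] by blast
    ultimately show "\<phi> t \<in> above_horizontal - B" using t by auto
  qed
qed

end

section \<open>From the Lyapunov function to an invariant neighbourhood\<close>

theorem theorem3p2:
  fixes m t\<^sub>0 :: real
    and u :: "real \<times> real \<times> real \<times> real \<times> real \<Rightarrow> real"
    and \<mu> :: state
    and U :: "state set"
    and V :: "state \<Rightarrow> real"
    and gradV :: "state \<Rightarrow> state"
  assumes "m > 0"
    and "u \<in> Lip"
    and "\<mu> \<in> above_horizontal"
    and "equilibrium (cart_pendulum m u) \<mu>"
    and "closedin (top_of_set above_horizontal) U"
    and "\<mu> \<in> U - frontier U"
    and "C1_on_with_gradient U V gradV"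
    and L1: "V \<mu> = 0" "\<forall>z\<in>U - {\<mu>}. V z > 0"
    and L2: "\<forall>z\<in>U - {\<mu>}. \<forall>t. derivative_along (cart_pendulum m u) gradV t z < 0"
  shows "\<exists>z\<^sub>0 B. open B \<and> \<mu> \<in> B \<and> B \<subseteq> above_horizontal \<and>
    (\<exists>J \<phi>. maximal_solution (cart_pendulum m u) t\<^sub>0 z\<^sub>0 J \<phi>) \<and>
    (\<forall>J \<phi>. maximal_solution (cart_pendulum m u) t\<^sub>0 z\<^sub>0 J \<phi> \<longrightarrow>
       (\<forall>t\<in>J. t \<ge> t\<^sub>0 \<longrightarrow> \<phi> t \<in> above_horizontal - B))"
proof -
  interpret cart_pendulum_system m u t\<^sub>0 using assms(1,2) by unfold_locales
  have U: "U \<subseteq> above_horizontal" using assms(5) by (meson closedin_imp_subset)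
  have "\<mu> \<in> interior U"
    using assms(6) closure_subset by (auto simp: frontier_def)
  then obtain r where r: "r > 0" "cball \<mu> r \<subseteq> interior U"
    using open_contains_cball open_interior by blast
  have rU: "cball \<mu> r \<subseteq> U" using r interior_subset by blast
  \<comment> \<open>The ball lies in the interior of \<open>U\<close>, where the derivative within
    \<open>U\<close> is the ordinary one.\<close>
  have deriv: "(V has_derivative (\<lambda>h. gradV z \<bullet> h)) (at z)" if "z \<in> cball \<mu> r" for z
  proof -
    have "z \<in> interior U" "z \<in> U" using r rU that by auto
    then show ?thesis
      using assms(7) unfolding C1_on_with_gradient_def by (metis at_within_interior)
  qed
  have cont: "continuous_on S V" if "S \<subseteq> cball \<mu> r" for S
    using deriv that by (intro continuous_at_imp_continuous_on ballI) (meson has_derivative_continuous subsetD)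
  \<comment> \<open>(L2) is silent at \<mu>; there the field itself vanishes.\<close>
  have "derivative_along (cart_pendulum m u) gradV t \<mu> = 0" for t
    using assms(4) by (simp add: derivative_along_def equilibrium_def)
  then have decr: "derivative_along (cart_pendulum m u) gradV t z \<le> 0" if "z \<in> cball \<mu> r" for t z
    using L2 subsetD[OF rU that] by (cases "z = \<mu>") (simp_all add: less_imp_le)
  have "sphere \<mu> r \<noteq> {}" using r(1) by simp
  \<comment> \<open>The minimum of \<open>V\<close> on the compact sphere is positive by (L1) and
    provides the barrier level.\<close>
  then obtain w where w: "w \<in> sphere \<mu> r" "\<forall>z\<in>sphere \<mu> r. V w \<le> V z"
    using continuous_attains_inf[OF compact_sphere, of \<mu> r V] cont[of "sphere \<mu> r"] by auto
  have "w \<noteq> \<mu>" "w \<in> U" using w(1) r(1) rU by auto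
  then have "V w > 0" using L1(2) by simp
  \<comment> \<open>The intersection with the ball confines the sublevel set to the region where
    \<open>V\<close> is controlled; outside \<open>U\<close> its values are arbitrary.\<close>
  define B where "B = {z \<in> ball \<mu> r. V z < V w}"
  have B: "open B" "\<mu> \<in> B" "B \<subseteq> above_horizontal"
  proof -
    show "open B"
      using continuous_open_preimage[OF cont[of "ball \<mu> r"], of "{..<V w}"]
      by (auto simp: B_def vimage_def Int_def)
    show "\<mu> \<in> B" using r(1) L1(1) \<open>V w > 0\<close> by (simp add: B_def)
    show "B \<subseteq> above_horizontal" using rU U ball_subset_cball[of \<mu> r] unfolding B_def by blast
  qed
  have invariant: "\<phi> t \<in> B"
    if "solution_on (cart_pendulum m u) J \<phi>" "{s..t} \<subseteq> J" "s \<le> t" "\<phi> s \<in> B" for J \<phi> s t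
    using sublevel_ball_forward_invariant[OF that(1-3) deriv decr, of \<mu> r "V w"] that(4) w(2)
    unfolding B_def by blast
  obtain z where z: "\<And>J \<phi> t. maximal_solution (cart_pendulum m u) t\<^sub>0 z J \<phi> \<Longrightarrow> t \<in> J \<Longrightarrow> t\<^sub>0 \<le> t \<Longrightarrow>
    \<phi> t \<in> above_horizontal - B"
  proof (rule exists_trajectory_avoiding[OF B(1,3)])
    show "\<phi> t \<in> B"
      if "solution_on (cart_pendulum m u) J \<phi>" "{s..t} \<subseteq> J" "s \<le> t" "\<phi> s \<in> B" for J \<phi> s t
      using invariant[OF that] .
  qed (rule that)
  show ?thesis
  proof (intro exI[of _ z] exI[of _ B] conjI B allI impI ballI)
    show "\<exists>J \<phi>. maximal_solution (cart_pendulum m u) t\<^sub>0 z J \<phi>"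
      by (rule maximal_solution_exists[of t\<^sub>0 z]) blast
    show "\<phi> t \<in> above_horizontal - B"
      if "maximal_solution (cart_pendulum m u) t\<^sub>0 z J \<phi>" "t \<in> J" "t\<^sub>0 \<le> t" for J \<phi> t
      by (rule z[OF that])
  qed
qed

end
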